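(* Let $T$ be a tree of order $n\geq 4$. Then $\rho(T^{2})\geq \rho(P_{n}^{2})$, with equality if and only if $T$ is (isomorphic to) $P_{n}$.
   Context: All graphs are simple, undirected and finite. $\rho(G)$ is the spectral radius of the adjacency matrix of $G$. The square $G^2$ of a connected graph $G$ is obtained from $G$ by adding an edge between every pair of vertices at distance $2$ in $G$. $P_n$ is the path on $n$ vertices. *)

theory Defs
  imports
    "Graph_Theory.Graph_Theory"
    "Jordan_Normal_Form.Spectral_Radius"
begin

text \<open>
  A finite simple undirected graph is a \<open>pair_graph\<close>: a finite vertex set with a symmetric,
  irreflexive arc relation, each undirected edge being represented by its two orientations.

  The predicate \<open>tree\<close> of Graph_Theory is meant for directed graphs: there the closed walk
  \<open>u, v, u\<close> along the two orientations of one edge counts as a cycle, so no symmetric graph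
  with an edge satisfies it.  The cycles of an undirected graph are those of length at
  least 3.
\<close>

definition undirected_tree :: "'a pair_pre_digraph \<Rightarrow> bool" where
  "undirected_tree G \<longleftrightarrow>
     pair_graph G \<and> Digraph_Component.connected (with_proj G) \<and>
     \<not> (\<exists>p. pre_digraph.cycle (with_proj G) p \<and> length p \<ge> 3)"

text \<open>With unit weights the minimal cost of a walk is the usual distance, infinite if there is
  no walk.\<close>

definition graph_dist :: "'a pair_pre_digraph \<Rightarrow> 'a \<Rightarrow> 'a \<Rightarrow> ereal" where
  "graph_dist G u v = wf_digraph.\<mu> (with_proj G) (\<lambda>_. 1) u v"

definition graph_square :: "'a pair_pre_digraph \<Rightarrow> 'a pair_pre_digraph" where
  "graph_square G =
     \<lparr> pverts = pverts G,
       parcs = parcs G \<union> {(u, v). u \<in> pverts G \<and> v \<in> pverts G \<and> graph_dist G u v = 2} \<rparr>"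

definition path_graph :: "nat \<Rightarrow> nat pair_pre_digraph" where
  "path_graph n =
     \<lparr> pverts = {..<n},
       parcs = {(i, j). i < n \<and> j < n \<and> (j = Suc i \<or> i = Suc j)} \<rparr>"

definition adjacency_mat :: "'a pair_pre_digraph \<Rightarrow> 'a list \<Rightarrow> complex mat" where
  "adjacency_mat G xs =
     mat (length xs) (length xs) (\<lambda>(i, j). if (xs ! i, xs ! j) \<in> parcs G then 1 else 0)"

text \<open>The enumeration of the vertices is irrelevant, see \<open>graph_spectral_radius_eq\<close> below.\<close>

definition graph_spectral_radius :: "'a pair_pre_digraph \<Rightarrow> real" where
  "graph_spectral_radius G =
     spectral_radius (adjacency_mat G (SOME xs. distinct xs \<and> set xs = pverts G))"

lemma eigenvalue_adjacency_mat_iff: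
  assumes "distinct xs"
  shows "eigenvalue (adjacency_mat G xs) k \<longleftrightarrow>
    (\<exists>f. (\<exists>u\<in>set xs. f u \<noteq> 0) \<and>
         (\<forall>u\<in>set xs. (\<Sum>v\<in>set xs. if (u, v) \<in> parcs G then f v else 0) = k * f u))"
    (is "?L \<longleftrightarrow> ?R")
proof -
  let ?n = "length xs" and ?A = "adjacency_mat G xs"
  have A: "?A \<in> carrier_mat ?n ?n" by (simp add: adjacency_mat_def)
  have bij: "bij_betw ((!) xs) {0..<?n} (set xs)"
    using bij_betw_nth[OF assms, of "{..<?n}" "set xs"] by (simp add: atLeast0LessThan)
  have mult: "(?A *\<^sub>v vec ?n (\<lambda>i. f (xs ! i))) $ i =
      (\<Sum>v\<in>set xs. if (xs ! i, v) \<in> parcs G then f v else 0)" if "i < ?n" for f i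
  proof -
    have "(?A *\<^sub>v vec ?n (\<lambda>i. f (xs ! i))) $ i =
        (\<Sum>j = 0..<?n. if (xs ! i, xs ! j) \<in> parcs G then f (xs ! j) else 0)"
      using that by (auto simp: adjacency_mat_def scalar_prod_def intro!: sum.cong)
    also have "\<dots> = (\<Sum>v\<in>set xs. if (xs ! i, v) \<in> parcs G then f v else 0)"
      by (rule sum.reindex_bij_betw[OF bij])
    finally show ?thesis .
  qed
  have ev: "eigenvector ?A (vec ?n (\<lambda>i. f (xs ! i))) k \<longleftrightarrow>
    (\<exists>u\<in>set xs. f u \<noteq> 0) \<and>
         (\<forall>u\<in>set xs. (\<Sum>v\<in>set xs. if (u, v) \<in> parcs G then f v else 0) = k * f u)" for f
  proof -
    have "vec ?n (\<lambda>i. f (xs ! i)) = 0\<^sub>v ?n \<longleftrightarrow> (\<forall>u\<in>set xs. f u = 0)"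
      by (auto simp: vec_eq_iff all_set_conv_all_nth)
    moreover have "?A *\<^sub>v vec ?n (\<lambda>i. f (xs ! i)) = k \<cdot>\<^sub>v vec ?n (\<lambda>i. f (xs ! i)) \<longleftrightarrow>
      (\<forall>u\<in>set xs. (\<Sum>v\<in>set xs. if (u, v) \<in> parcs G then f v else 0) = k * f u)"
      using A mult[of _ f] by (subst vec_eq_iff) (auto simp: all_set_conv_all_nth)
    ultimately show ?thesis using A by (auto simp: eigenvector_def)
  qed
  show ?thesis
  proof
    assume ?L
    then obtain w where w: "eigenvector ?A w k" by (auto simp: eigenvalue_def)
    then have dim: "dim_vec w = ?n" using A by (auto simp: eigenvector_def)
    define f where "f u = w $ (the_inv_into {0..<?n} ((!) xs) u)" for u
    have "f (xs ! i) = w $ i" if "i < ?n" for i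
      using the_inv_into_f_f[OF bij_betw_imp_inj_on[OF bij], of i] that by (simp add: f_def)
    then have "w = vec ?n (\<lambda>i. f (xs ! i))"
      by (intro eq_vecI) (simp_all add: dim)
    with w have "eigenvector ?A (vec ?n (\<lambda>i. f (xs ! i))) k" by simp
    then show ?R by (intro exI[of _ f]) (rule iffD1[OF ev])
  next
    assume ?R
    then obtain f where "eigenvector ?A (vec ?n (\<lambda>i. f (xs ! i))) k"
      by (elim exE) (drule iffD2[OF ev], rule that)
    then show ?L unfolding eigenvalue_def by (rule exI)
  qed
qed

lemma graph_spectral_radius_eq:
  assumes "distinct xs" "set xs = pverts G"
  shows "graph_spectral_radius G = spectral_radius (adjacency_mat G xs)"
proof -
  define ys where "ys = (SOME xs. distinct xs \<and> set xs = pverts G)"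
  have "distinct ys \<and> set ys = pverts G"
    unfolding ys_def by (rule someI[of _ xs]) (rule conjI[OF assms])
  then have ys: "distinct ys" "set ys = set xs" using assms(2) by auto
  have "eigenvalue (adjacency_mat G ys) = eigenvalue (adjacency_mat G xs)"
    unfolding fun_eq_iff eigenvalue_adjacency_mat_iff[OF ys(1)] eigenvalue_adjacency_mat_iff[OF assms(1)] ys(2)
    by (intro allI refl)
  then show ?thesis
    unfolding graph_spectral_radius_def spectral_radius_def spectrum_def ys_def[symmetric] by simp
qed

end

theory Submission
  imports Defs "HOL-Analysis.Function_Topology"
begin

text \<open>
  List the vertices of \<open>P\<^sub>n\<close> from the middle outwards, alternating sides. In this order the
  adjacency matrix of \<open>P\<^sub>n\<^sup>2\<close> plus the identity preserves the cone of nonincreasing nonnegative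
  vectors, so the Perron vector \<open>y\<close> of \<open>P\<^sub>n\<^sup>2\<close> is nonincreasing, and every vertex of rank
  \<open>j \<ge> 3\<close> has exactly two earlier neighbours, of rank \<open>j - 2\<close> and \<open>j - 4\<close> (counting from 0, with
  truncated subtraction).

  The vertices of any tree \<open>T\<close> can be listed such that each vertex of rank \<open>j \<ge> 1\<close> has exactly one
  earlier neighbour, its parent, of rank at most \<open>j - 2\<close>: unless \<open>T\<close> is a star, remove two leaves
  with distinct neighbours, list the rest, and append the two leaves in the order of the ranks of
  their neighbours. The parent and grandparent (or the vertex of rank 1, if the parent has rank 0)
  are then earlier neighbours in \<open>T\<^sup>2\<close> of ranks at most \<open>j - 2\<close> and \<open>j - 4\<close>. Hence the quadratic form
  of \<open>T\<^sup>2\<close> at \<open>y\<close> is at least that of \<open>P\<^sub>n\<^sup>2\<close>. If \<open>T\<close> is not a path, the first vertex whose parent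
  differs from the parent in the path has an earlier sibling, a third earlier neighbour, which makes
  the inequality strict.
\<close>

section \<open>Rayleigh quotients on invariant cones\<close>

text \<open>A maximiser of the Rayleigh quotient over \<open>K\<close> may lie on the boundary of
  the cone, so the usual criticality argument, which tests all directions, does not apply. Only
  directions inside \<open>K\<close> are available, and by invariance \<open>M x\<close> is one of
  them, which is enough. Applied to two cones: all nonnegative vectors, and the nonincreasing
  ones.\<close>

lemma cone_rayleigh_eigenvector:
  fixes a :: "nat \<Rightarrow> nat \<Rightarrow> real" and K :: "(nat \<Rightarrow> real) set" and n :: nat
  defines "M \<equiv> \<lambda>x i. if i < n then \<Sum>j<n. a i j * x j else 0"
  assumes sym: "\<And>i j. a i j = a j i"
    and closed: "closed K"
    and nonneg: "\<And>x i. x \<in> K \<Longrightarrow> 0 \<le> x i"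
    and supp: "\<And>x i. x \<in> K \<Longrightarrow> n \<le> i \<Longrightarrow> x i = 0"
    and zero: "(\<lambda>_. 0) \<in> K"
    and cone: "\<And>x y t. x \<in> K \<Longrightarrow> y \<in> K \<Longrightarrow> 0 \<le> t \<Longrightarrow> (\<lambda>i. x i + t * y i) \<in> K"
    and nontriv: "e \<in> K" "e \<noteq> (\<lambda>_. 0)"
    and inv: "\<And>x. x \<in> K \<Longrightarrow> M x \<in> K"
  obtains x m where "x \<in> K" "(\<Sum>i<n. (x i)\<^sup>2) = 1"
    "\<And>i. i < n \<Longrightarrow> (\<Sum>j<n. a i j * x j) = m * x i"
    "\<And>y. y \<in> K \<Longrightarrow> (\<Sum>i<n. \<Sum>j<n. a i j * y i * y j) \<le> m * (\<Sum>i<n. (y i)\<^sup>2)"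
proof -
  define ip where "ip x y = (\<Sum>i<n. x i * y i)" for x y :: "nat \<Rightarrow> real"
  define Q where "Q x = (\<Sum>i<n. \<Sum>j<n. a i j * x i * x j)" for x :: "nat \<Rightarrow> real"
  have ip_self: "ip x x = (\<Sum>i<n. (x i)\<^sup>2)" for x
    by (simp add: ip_def power2_eq_square)
  have Q_eq: "Q x = ip x (M x)" for x
    by (simp add: Q_def ip_def M_def sum_distrib_left mult_ac)
  have ip_comm: "ip x y = ip y x" for x y
    by (simp add: ip_def mult.commute)
  have ip_lin: "ip z (\<lambda>i. x i + t * y i) = ip z x + t * ip z y" for x y z t
    by (simp add: ip_def sum.distrib sum_distrib_left algebra_simps)
  have M_lin: "M (\<lambda>i. x i + t * y i) = (\<lambda>i. M x i + t * M y i)" for x y t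
    by (rule ext) (simp add: M_def sum.distrib sum_distrib_left algebra_simps)
  have M_sym: "ip x (M y) = ip y (M x)" for x y
  proof -
    have "ip x (M y) = (\<Sum>i<n. \<Sum>j<n. a i j * x i * y j)"
      by (simp add: ip_def M_def sum_distrib_left mult_ac)
    also have "\<dots> = (\<Sum>j<n. \<Sum>i<n. a i j * x i * y j)" by (rule sum.swap)
    also have "\<dots> = ip y (M x)"
      by (simp add: ip_def M_def sum_distrib_left mult_ac sym)
    finally show ?thesis .
  qed
  have ip_expand: "ip (\<lambda>i. x i + t * y i) (\<lambda>i. x i + t * y i)
      = ip x x + 2 * t * ip x y + t\<^sup>2 * ip y y" for x y t
    unfolding ip_lin ip_comm[of "\<lambda>i. x i + t * y i"]
    by (simp add: ip_comm[of y x] power2_eq_square algebra_simps)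
  have Q_expand: "Q (\<lambda>i. x i + t * y i) = Q x + 2 * t * ip y (M x) + t\<^sup>2 * Q y" for x y t
    unfolding Q_eq M_lin ip_lin ip_comm[of "\<lambda>i. x i + t * y i"]
    by (simp add: ip_comm[of "M _"] M_sym[of x y] power2_eq_square algebra_simps)
  have coord: "continuous_on S (\<lambda>x::nat \<Rightarrow> real. x i)" for S i
    by (rule continuous_on_subset[OF continuous_on_product_coordinates]) auto
  define S where "S = K \<inter> {x. ip x x = 1}"
  \<comment> \<open>Vectors are functions on all of \<open>nat\<close>, so compactness comes from
    Tychonoff: unit vectors of the cone have all coordinates in \<open>[0, 1]\<close>.\<close>
  have "compact (PiE UNIV (\<lambda>_::nat. {0..1::real}))"
    using compactin_PiE[of "\<lambda>_. euclidean" UNIV "\<lambda>_::nat. {0..1::real}"]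
    by (simp add: euclidean_product_topology)
  moreover have "S \<subseteq> PiE UNIV (\<lambda>_::nat. {0..1::real})"
  proof
    fix x assume x: "x \<in> S"
    have "x i \<le> 1" for i
    proof (cases "i < n")
      case True
      then have "(x i)\<^sup>2 \<le> (\<Sum>i<n. (x i)\<^sup>2)"
        by (intro member_le_sum) auto
      also have "\<dots> = 1\<^sup>2" using x by (simp add: S_def ip_self)
      finally show ?thesis by (rule power2_le_imp_le) simp
    next
      case False
      with x supp[of x i] show ?thesis by (auto simp: S_def)
    qed
    with x nonneg show "x \<in> PiE UNIV (\<lambda>_::nat. {0..1::real})" by (auto simp: S_def)
  qed
  moreover have "closed S"
    unfolding S_def ip_def
    by (intro closed_Int closed closed_Collect_eq continuous_intros coord)
  ultimately have comp: "compact S"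
    using compact_Int_closed by (metis inf.absorb_iff2)
  \<comment> \<open>Scaling is written as \<open>0 + t * y i\<close> so that \<open>cone\<close>,
    \<open>ip_expand\<close> and \<open>Q_expand\<close> apply with the zero vector as first
    summand.\<close>
  have normalize: "(\<lambda>i. 0 + 1 / sqrt (ip y y) * y i) \<in> S" if "y \<in> K" and pos: "0 < ip y y" for y
  proof -
    have "(\<lambda>i. 0 + 1 / sqrt (ip y y) * y i) \<in> K"
      using pos by (intro cone zero that) simp
    moreover have "ip (\<lambda>i. 0 + 1 / sqrt (ip y y) * y i) (\<lambda>i. 0 + 1 / sqrt (ip y y) * y i) = 1"
      unfolding ip_expand using pos by (simp add: power_divide) (simp add: ip_def)
    ultimately show ?thesis unfolding S_def by blast
  qed
  have ne: "S \<noteq> {}"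
  proof -
    from nontriv supp obtain k where k: "k < n" "e k \<noteq> 0"
      by (metis ext not_le)
    then have pos: "0 < ip e e"
      unfolding ip_self by (intro sum_pos2[of _ k]) auto
    with normalize[OF nontriv(1)] show ?thesis by blast
  qed
  have cont: "continuous_on S Q"
    unfolding Q_def by (intro continuous_intros coord)
  obtain x where x: "x \<in> S" and max: "\<And>y. y \<in> S \<Longrightarrow> Q y \<le> Q x"
    using continuous_attains_sup[OF comp ne cont] by blast
  then have xK: "x \<in> K" and x1: "ip x x = 1" by (auto simp: S_def)
  define m where "m = Q x"
  have bound: "Q y \<le> m * ip y y" if "y \<in> K" for y
  proof (cases "ip y y = 0")
    case True
    then have "y i = 0" if "i < n" for i
      using that unfolding ip_self by (subst (asm) sum_nonneg_eq_0_iff) auto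
    then show ?thesis by (simp add: Q_def ip_def)
  next
    case False
    then have pos: "0 < ip y y"
      by (metis ip_self order_le_less sum_nonneg zero_le_power2)
    let ?y = "\<lambda>i. 0 + 1 / sqrt (ip y y) * y i"
    have "?y \<in> S" by (rule normalize[OF that pos])
    then have "Q ?y \<le> m" using max m_def by blast
    moreover have "Q ?y = Q y / ip y y"
      unfolding Q_expand using pos by (simp add: power_divide) (simp add: Q_def ip_def M_def)
    ultimately have "Q y / ip y y \<le> m" by metis
    with pos show ?thesis by (simp add: pos_divide_le_eq)
  qed
  txt \<open>Since \<open>x + t * M x\<close> stays in the cone for \<open>t > 0\<close>, maximality of \<open>x\<close> gives
    \<open>\<parallel>M x\<parallel> \<le> m\<close>, and then \<open>\<parallel>M x - m x\<parallel>\<^sup>2 \<le> m\<^sup>2 - 2 m\<^sup>2 + m\<^sup>2 = 0\<close>.\<close>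
  have MM: "ip (M x) (M x) \<le> m\<^sup>2"
  proof (rule ccontr)
    define d where "d = ip (M x) (M x) - m\<^sup>2"
    define C where "C = \<bar>Q (M x) - m * ip (M x) (M x)\<bar> + 1"
    assume "\<not> ?thesis"
    then have d: "0 < d" by (simp add: d_def)
    have C: "0 < C" by (simp add: C_def)
    have C_ge: "- C \<le> Q (M x) - m * ip (M x) (M x)" unfolding C_def by linarith
    \<comment> \<open>With this \<open>t\<close> the second-order loss is at most
      \<open>t\<^sup>2 * C = t * d\<close>, half of the first-order gain
      \<open>2 * t * d\<close>.\<close>
    define t where "t = d / C"
    have t: "0 < t" using d C by (simp add: t_def)
    have "Q (\<lambda>i. x i + t * M x i) \<le> m * ip (\<lambda>i. x i + t * M x i) (\<lambda>i. x i + t * M x i)"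
      using t by (intro bound cone xK inv) auto
    then have "2 * t * d + t\<^sup>2 * (Q (M x) - m * ip (M x) (M x)) \<le> 0"
      unfolding Q_expand ip_expand x1 m_def[symmetric] d_def Q_eq[of x, symmetric]
      by (simp add: algebra_simps power2_eq_square)
    moreover have "- (t\<^sup>2 * C) \<le> t\<^sup>2 * (Q (M x) - m * ip (M x) (M x))"
      using mult_left_mono[OF C_ge, of "t\<^sup>2"] by simp
    moreover have "t\<^sup>2 * C = t * d" using C by (simp add: t_def power2_eq_square)
    moreover have "0 < t * d" using t d by simp
    ultimately show False by linarith
  qed
  have "(\<Sum>i<n. (M x i - m * x i)\<^sup>2) = ip (M x) (M x) - 2 * m * ip x (M x) + m\<^sup>2 * ip x x"
    unfolding ip_def
    by (simp add: power2_eq_square algebra_simps sum.distrib sum_subtractf sum_distrib_left)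
  also have "\<dots> \<le> 0" using MM unfolding x1 Q_eq[symmetric] m_def[symmetric]
    by (simp add: power2_eq_square)
  finally have "(\<Sum>i<n. (M x i - m * x i)\<^sup>2) = 0"
    by (intro antisym sum_nonneg) auto
  then have "M x i = m * x i" if "i < n" for i
    using that by (subst (asm) sum_nonneg_eq_0_iff) auto
  then show thesis
    using that[of x m] xK x1 bound unfolding ip_self Q_def M_def by simp
qed

section \<open>Spectral radius and eigenvectors of the adjacency matrix\<close>

lemma sum_set_nth:
  assumes "distinct xs"
  shows "(\<Sum>v\<in>set xs. g v) = (\<Sum>j<length xs. g (xs ! j))"
  using sum.reindex_bij_betw[OF bij_betw_nth[OF assms refl refl], of g] by simp

lemma eigenvalue_le_graph_spectral_radius:
  fixes x :: "nat \<Rightarrow> real"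
  assumes xs: "distinct xs" "set xs = pverts G"
    and i: "i < length xs" "x i \<noteq> 0"
    and ev: "\<And>i. i < length xs \<Longrightarrow>
      (\<Sum>j<length xs. if (xs ! i, xs ! j) \<in> parcs G then x j else 0) = m * x i"
  shows "m \<le> graph_spectral_radius G"
proof -
  let ?n = "length xs"
  define f where "f v = complex_of_real (x (the_inv_into {..<?n} ((!) xs) v))" for v
  have f: "f (xs ! j) = x j" if "j < ?n" for j
    using the_inv_into_f_f[of "(!) xs" "{..<?n}" j] that xs(1)
    by (simp add: f_def inj_on_nth)
  have "(\<Sum>v\<in>set xs. if (u, v) \<in> parcs G then f v else 0) = complex_of_real m * f u"
    if u: "u \<in> set xs" for u
  proof -
    obtain k where k: "k < ?n" "u = xs ! k" using u by (auto simp: in_set_conv_nth)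
    have "(\<Sum>v\<in>set xs. if (u, v) \<in> parcs G then f v else 0)
        = (\<Sum>j<?n. if (u, xs ! j) \<in> parcs G then f (xs ! j) else 0)"
      by (rule sum_set_nth[OF xs(1)])
    also have "\<dots> = (\<Sum>j<?n. complex_of_real (if (u, xs ! j) \<in> parcs G then x j else 0))"
      by (intro sum.cong) (auto simp: f)
    also have "\<dots> = complex_of_real (\<Sum>j<?n. if (u, xs ! j) \<in> parcs G then x j else 0)"
      by simp
    also have "\<dots> = complex_of_real m * f u"
      unfolding k(2) ev[OF k(1)] using f[OF k(1)] by simp
    finally show ?thesis .
  qed
  moreover have "\<exists>u\<in>set xs. f u \<noteq> 0"
    using i f[OF i(1)] by (intro bexI[of _ "xs ! i"]) auto
  ultimately have "eigenvalue (adjacency_mat G xs) (complex_of_real m)"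
    unfolding eigenvalue_adjacency_mat_iff[OF xs(1)] by blast
  then have mem: "norm (complex_of_real m) \<in> norm ` spectrum (adjacency_mat G xs)"
    unfolding spectrum_def by blast
  have "m \<le> norm (complex_of_real m)" by simp
  also have "\<dots> \<le> spectral_radius (adjacency_mat G xs)"
    by (rule spectral_radius_mem_max(2)[of _ ?n, OF _ _ mem]) (use i in \<open>auto simp: adjacency_mat_def\<close>)
  finally show ?thesis unfolding graph_spectral_radius_eq[OF xs] .
qed

text \<open>Perron's argument: for an eigenvector \<open>f\<close> of an eigenvalue \<open>k\<close>
  of maximal modulus, the triangle inequality bounds \<open>|k| |f|\<close> entrywise by the
  adjacency matrix applied to \<open>|f|\<close>. Pairing with the positive eigenvector
  \<open>x\<close> turns this into \<open>|k| <= m\<close>.\<close>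

lemma graph_spectral_radius_le_of_positive_eigenvector:
  fixes x :: "nat \<Rightarrow> real"
  assumes xs: "distinct xs" "set xs = pverts G" "xs \<noteq> []"
    and sym: "\<And>u v. (u, v) \<in> parcs G \<Longrightarrow> (v, u) \<in> parcs G"
    and pos: "\<And>i. i < length xs \<Longrightarrow> 0 < x i"
    and ev: "\<And>i. i < length xs \<Longrightarrow>
      (\<Sum>j<length xs. if (xs ! i, xs ! j) \<in> parcs G then x j else 0) = m * x i"
  shows "graph_spectral_radius G \<le> m"
proof -
  let ?n = "length xs"
  let ?e = "\<lambda>i j. (xs ! i, xs ! j) \<in> parcs G"
  have "spectral_radius (adjacency_mat G xs) \<in> norm ` spectrum (adjacency_mat G xs)"
    by (rule spectral_radius_mem_max(1)[of _ ?n]) (use xs in \<open>auto simp: adjacency_mat_def\<close>)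
  then obtain k where k: "eigenvalue (adjacency_mat G xs) k"
      and rad: "spectral_radius (adjacency_mat G xs) = norm k"
    by (auto simp: spectrum_def)
  from k obtain f where f0: "\<exists>u\<in>set xs. f u \<noteq> 0"
    and fev: "\<And>u. u \<in> set xs \<Longrightarrow>
      (\<Sum>v\<in>set xs. if (u, v) \<in> parcs G then f v else 0) = k * f u"
    unfolding eigenvalue_adjacency_mat_iff[OF xs(1)] by blast
  define g where "g j = norm (f (xs ! j))" for j
  from f0 obtain l where l: "l < ?n" "0 < g l"
    by (auto simp: in_set_conv_nth g_def)
  have le: "norm k * g i \<le> (\<Sum>j<?n. if ?e i j then g j else 0)" if "i < ?n" for i
  proof -
    have "norm k * g i = norm (\<Sum>v\<in>set xs. if (xs ! i, v) \<in> parcs G then f v else 0)"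
      using that by (subst fev) (auto simp: g_def norm_mult)
    also have "\<dots> = norm (\<Sum>j<?n. if ?e i j then f (xs ! j) else 0)"
      by (subst sum_set_nth[OF xs(1)]) simp
    also have "\<dots> \<le> (\<Sum>j<?n. norm (if ?e i j then f (xs ! j) else 0))"
      by (rule norm_sum)
    also have "\<dots> = (\<Sum>j<?n. if ?e i j then g j else 0)"
      by (intro sum.cong) (auto simp: g_def)
    finally show ?thesis .
  qed
  have "norm k * (\<Sum>i<?n. x i * g i) = (\<Sum>i<?n. x i * (norm k * g i))"
    by (simp add: sum_distrib_left mult_ac)
  also have "\<dots> \<le> (\<Sum>i<?n. x i * (\<Sum>j<?n. if ?e i j then g j else 0))"
    by (intro sum_mono mult_left_mono le) (auto intro: less_imp_le[OF pos])
  also have "\<dots> = (\<Sum>i<?n. \<Sum>j<?n. if ?e i j then x i * g j else 0)"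
    by (simp add: sum_distrib_left if_distrib cong: if_cong)
  also have "\<dots> = (\<Sum>j<?n. \<Sum>i<?n. if ?e i j then x i * g j else 0)"
    by (rule sum.swap)
  \<comment> \<open>Symmetry moves the adjacency matrix from \<open>g\<close> to \<open>x\<close>,
    where the eigenvalue equation applies.\<close>
  also have "\<dots> = (\<Sum>j<?n. \<Sum>i<?n. if ?e j i then x i * g j else 0)"
    by (intro sum.cong refl if_cong) (auto intro: sym)
  also have "\<dots> = (\<Sum>j<?n. (\<Sum>i<?n. if ?e j i then x i else 0) * g j)"
    by (simp add: sum_distrib_right if_distrib if_distribR cong: if_cong)
  also have "\<dots> = m * (\<Sum>i<?n. x i * g i)"
    by (simp add: ev sum_distrib_left mult_ac)
  finally have "norm k * (\<Sum>i<?n. x i * g i) \<le> m * (\<Sum>i<?n. x i * g i)" .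
  moreover have "0 < (\<Sum>i<?n. x i * g i)"
  proof (rule sum_pos2[of _ l])
    show "0 \<le> x i * g i" if "i \<in> {..<?n}" for i
      using pos[of i] that by (simp add: g_def)
  qed (use l pos[of l] in auto)
  ultimately show ?thesis
    unfolding graph_spectral_radius_eq[OF xs(1,2)] rad by simp
qed

section \<open>Squares of trees given by parent functions\<close>

text \<open>Each edge is counted at its later endpoint, once for each orientation. This allows two
  quadratic forms to be compared one rank at a time.\<close>

lemma quadratic_form_eq_sum_earlier:
  fixes y :: "nat \<Rightarrow> real"
  assumes "\<And>i j. R i j \<longleftrightarrow> R j i" "\<And>i. \<not> R i i"
  shows "(\<Sum>i<n. \<Sum>j<n. if R i j then y i * y j else 0)
    = 2 * (\<Sum>j<n. y j * (\<Sum>i<j. if R i j then y i else 0))"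
proof (induction n)
  case (Suc n)
  have "(\<Sum>i<Suc n. \<Sum>j<Suc n. if R i j then y i * y j else 0)
      = (\<Sum>i<n. \<Sum>j<n. if R i j then y i * y j else 0)
        + (\<Sum>i<n. if R i n then y i * y n else 0) + (\<Sum>j<n. if R n j then y n * y j else 0)"
    using assms(2) by (simp add: sum.distrib)
  moreover have "(\<Sum>i<n. if R i n then y i * y n else 0) = y n * (\<Sum>i<n. if R i n then y i else 0)"
    by (auto simp: sum_distrib_left intro!: sum.cong)
  moreover have "(\<Sum>j<n. if R n j then y n * y j else 0) = y n * (\<Sum>i<n. if R i n then y i else 0)"
    unfolding sum_distrib_left by (intro sum.cong refl) (use assms(1) in auto)
  ultimately show ?case using Suc by (simp add: algebra_simps)
qed simp

lemma closed_nonneg_supported: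
  "closed {x :: nat \<Rightarrow> real. (\<forall>i. 0 \<le> x i) \<and> (\<forall>i\<ge>n. x i = 0)}"
proof -
  have "{x :: nat \<Rightarrow> real. (\<forall>i. 0 \<le> x i) \<and> (\<forall>i\<ge>n. x i = 0)}
      = (\<Inter>i. {x. 0 \<le> x i}) \<inter> (\<Inter>i\<in>{n..}. {x. x i = 0})"
    by auto
  then show ?thesis
    by (auto intro!: closed_Int closed_INT closed_Collect_le closed_Collect_eq
        continuous_on_const continuous_on_product_coordinates)
qed

lemma nonneg_rayleigh_maximum:
  fixes R :: "nat \<Rightarrow> nat \<Rightarrow> bool"
  assumes sym: "\<And>i j. R i j \<longleftrightarrow> R j i" and n: "0 < n"
  obtains x and m :: real where "\<exists>i<n. x i \<noteq> 0"
    "\<And>i. i < n \<Longrightarrow> (\<Sum>j<n. if R i j then x j else 0) = m * x i"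
    "\<And>y. \<forall>i<n. 0 \<le> y i \<Longrightarrow>
      (\<Sum>i<n. \<Sum>j<n. if R i j then y i * y j else 0) \<le> m * (\<Sum>i<n. (y i)\<^sup>2)"
proof -
  define K where "K = {x :: nat \<Rightarrow> real. (\<forall>i. 0 \<le> x i) \<and> (\<forall>i\<ge>n. x i = 0)}"
  define a where "a i j = (of_bool (R i j) :: real)" for i j
  define e where "e i = (if i < n then 1 else 0 :: real)" for i
  have "e \<noteq> (\<lambda>_. 0)" using n by (auto simp: e_def fun_eq_iff)
  have "\<exists>x m. x \<in> K \<and> (\<Sum>i<n. (x i)\<^sup>2) = 1 \<and> (\<forall>i<n. (\<Sum>j<n. a i j * x j) = m * x i) \<and>
      (\<forall>y\<in>K. (\<Sum>i<n. \<Sum>j<n. a i j * y i * y j) \<le> m * (\<Sum>i<n. (y i)\<^sup>2))"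
  proof (rule cone_rayleigh_eigenvector[of a K n e])
    show "closed K" unfolding K_def by (rule closed_nonneg_supported)
    show "(\<lambda>i. x i + t * y i) \<in> K" if "x \<in> K" "y \<in> K" "0 \<le> t" for x y t
      using that by (auto simp: K_def)
    show "(\<lambda>i. if i < n then \<Sum>j<n. a i j * x j else 0) \<in> K" if "x \<in> K" for x
      using that by (auto simp: K_def a_def intro!: sum_nonneg)
    show "x i = 0" if "x \<in> K" "n \<le> i" for x i using that by (auto simp: K_def)
      show "a i j = a j i" for i j using sym[of i j] by (simp add: a_def)
    show "0 \<le> x i" if "x \<in> K" for x i using that by (auto simp: K_def)
    show "(\<lambda>_. 0) \<in> K" "e \<in> K" "e \<noteq> (\<lambda>_. 0)"
      using \<open>e \<noteq> (\<lambda>_. 0)\<close> by (auto simp: K_def e_def)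
  qed blast
  then obtain x m where x: "(\<Sum>i<n. (x i)\<^sup>2) = 1"
    and ev: "\<And>i. i < n \<Longrightarrow> (\<Sum>j<n. a i j * x j) = m * x i"
    and bound: "\<forall>y\<in>K. (\<Sum>i<n. \<Sum>j<n. a i j * y i * y j) \<le> m * (\<Sum>i<n. (y i)\<^sup>2)"
    by blast
  have "\<exists>i<n. x i \<noteq> 0"
  proof (rule ccontr)
    assume "\<not> ?thesis"
    then have "(\<Sum>i<n. (x i)\<^sup>2) = 0" by simp
    with x show False by simp
  qed
  moreover have "(\<Sum>j<n. if R i j then x j else 0) = m * x i" if "i < n" for i
    unfolding ev[OF that, symmetric] by (intro sum.cong) (auto simp: a_def)
  moreover have "(\<Sum>i<n. \<Sum>j<n. if R i j then y i * y j else 0) \<le> m * (\<Sum>i<n. (y i)\<^sup>2)"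
    if y: "\<forall>i<n. 0 \<le> y i" for y
  proof -
    \<comment> \<open>Nothing is known about \<open>y\<close> from \<open>n\<close> on, so it is cut
      off there to lie in the cone.\<close>
    let ?y = "\<lambda>i. if i < n then y i else 0"
    have "(\<Sum>i<n. \<Sum>j<n. a i j * ?y i * ?y j) \<le> m * (\<Sum>i<n. (?y i)\<^sup>2)"
      using y by (intro bspec[OF bound, of ?y]) (auto simp: K_def)
    moreover have "(\<Sum>i<n. \<Sum>j<n. if R i j then y i * y j else 0)
        = (\<Sum>i<n. \<Sum>j<n. a i j * ?y i * ?y j)"
      by (intro sum.cong) (auto simp: a_def)
    ultimately show ?thesis by simp
  qed
  ultimately show thesis by (rule that)
qed

text \<open>A tree on an initial segment of the natural numbers, given by the parent \<open>p j < j\<close> of each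
  \<open>j > 0\<close>; the value \<open>p 0\<close> is irrelevant.\<close>

definition parent_adj :: "(nat \<Rightarrow> nat) \<Rightarrow> nat \<Rightarrow> nat \<Rightarrow> bool" where
  "parent_adj p i j \<longleftrightarrow> i < j \<and> p j = i \<or> j < i \<and> p i = j"

definition parent_sq :: "(nat \<Rightarrow> nat) \<Rightarrow> nat \<Rightarrow> nat \<Rightarrow> nat \<Rightarrow> bool" where
  "parent_sq p n i j \<longleftrightarrow>
     i \<noteq> j \<and> (parent_adj p i j \<or> (\<exists>k<n. parent_adj p i k \<and> parent_adj p k j))"

text \<open>The path listed from the middle outwards; truncation makes 0 the parent of both 1 and 2.\<close>

definition path_parent :: "nat \<Rightarrow> nat" where
  "path_parent j = j - 2"

lemma parent_adj_commute: "parent_adj p i j \<longleftrightarrow> parent_adj p j i"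
  by (auto simp: parent_adj_def)

lemma parent_sq_commute: "parent_sq p n i j \<longleftrightarrow> parent_sq p n j i"
  unfolding parent_sq_def using parent_adj_commute by metis

lemma parent_sq_irrefl: "\<not> parent_sq p n i i"
  by (simp add: parent_sq_def)

section \<open>The path square in middle-outwards order and its Perron vector\<close>

lemma parent_adj_path_parent_iff:
  "parent_adj path_parent i j \<longleftrightarrow>
    j = i + 2 \<or> i = j + 2 \<or> i = 0 \<and> j = 1 \<or> i = 1 \<and> j = 0"
  by (auto simp: parent_adj_def path_parent_def)

text \<open>Along the path the ranks read ..., 4, 2, 0, 1, 3, .... Differences 2 and 4 are distances
  1 and 2 on one side; the remaining pairs 0-1, 0-3 and 1-2 straddle the middle.\<close>

lemma parent_sq_path_parent_iff:
  assumes "i < n" "j < n"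
  shows "parent_sq path_parent n i j \<longleftrightarrow>
    j = i + 2 \<or> i = j + 2 \<or> j = i + 4 \<or> i = j + 4 \<or>
    i = 0 \<and> (j = 1 \<or> j = 3) \<or> j = 0 \<and> (i = 1 \<or> i = 3) \<or> i = 1 \<and> j = 2 \<or> i = 2 \<and> j = 1"
    (is "_ \<longleftrightarrow> ?N")
proof
  assume "parent_sq path_parent n i j"
  then show ?N by (auto simp: parent_sq_def parent_adj_path_parent_iff)
next
  assume ?N
  moreover have "\<exists>k<n. parent_adj path_parent i k \<and> parent_adj path_parent k j" if "j = i + 4 \<or> i = j + 4"
    using that assms by (intro exI[of _ "min i j + 2"]) (auto simp: parent_adj_path_parent_iff)
  moreover have "\<exists>k<n. parent_adj path_parent i k \<and> parent_adj path_parent k j"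
    if "i = 0 \<and> j = 3 \<or> j = 0 \<and> i = 3"
    using that assms by (intro exI[of _ 1]) (auto simp: parent_adj_path_parent_iff)
  moreover have "\<exists>k<n. parent_adj path_parent i k \<and> parent_adj path_parent k j"
    if "i = 1 \<and> j = 2 \<or> i = 2 \<and> j = 1"
    using that assms by (intro exI[of _ 0]) (auto simp: parent_adj_path_parent_iff)
  ultimately show "parent_sq path_parent n i j"
    unfolding parent_sq_def by (auto simp: parent_adj_path_parent_iff)
qed

lemma sum_path_neighbours:
  fixes x :: "nat \<Rightarrow> real"
  assumes supp: "\<And>i. n \<le> i \<Longrightarrow> x i = 0" and i: "i < n"
    and N: "N = {j. j = i + 2 \<or> i = j + 2 \<or> j = i + 4 \<or> i = j + 4 \<or>
    i = 0 \<and> (j = 1 \<or> j = 3) \<or> j = 0 \<and> (i = 1 \<or> i = 3) \<or> i = 1 \<and> j = 2 \<or> i = 2 \<and> j = 1}"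
  shows "(\<Sum>j<n. if parent_sq path_parent n i j then x j else 0) = sum x N"
proof -
  have "N \<subseteq> {..i + 4}" unfolding N by auto
  then have fin: "finite N" by (rule finite_subset) simp
  have "(\<Sum>j<n. if parent_sq path_parent n i j then x j else 0)
      = (\<Sum>j<n. if j \<in> N then x j else 0)"
    by (intro sum.cong refl) (simp add: parent_sq_path_parent_iff[OF i] N)
  also have "\<dots> = sum x ({..<n} \<inter> N)"
    by (simp add: sum.If_cases)
  \<comment> \<open>As \<open>x\<close> vanishes from \<open>n\<close> on, neighbours beyond the
    ends of the path contribute nothing. The rows near the ends then have the same formula as those
    of an infinite path.\<close>
  also have "\<dots> = sum x N"
    by (rule sum.mono_neutral_left[OF fin]) (auto intro!: supp)
  finally show ?thesis .
qed

text \<open>With the identity added, every row has five entries. Listed in increasing order, the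
  positions in row \<open>i\<close> are at most those in row \<open>Suc i\<close>, term by term:
  01234, 01235, 01246, 01357, 02468, and shifts of the last. Without the identity this fails already
  for rows 0 and 1.\<close>

lemma path_row_antimono:
  fixes x :: "nat \<Rightarrow> real"
  assumes supp: "\<And>i. n \<le> i \<Longrightarrow> x i = 0" and anti: "antimono x" and i: "Suc i < n"
  defines "M \<equiv> \<lambda>i. (\<Sum>j<n. if parent_sq path_parent n i j then x j else 0) + x i"
  shows "M (Suc i) \<le> M i"
proof -
  have le: "x b \<le> x a" if "a \<le> b" for a b using anti that by (rule antimonoD)
  have row: "M i = sum x N + x i" if "i < n"
    "N = {j. j = i + 2 \<or> i = j + 2 \<or> j = i + 4 \<or> i = j + 4 \<or>
    i = 0 \<and> (j = 1 \<or> j = 3) \<or> j = 0 \<and> (i = 1 \<or> i = 3) \<or> i = 1 \<and> j = 2 \<or> i = 2 \<and> j = 1}" for i N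
    unfolding M_def by (simp add: sum_path_neighbours[OF supp that(1) that(2)])
  have r0: "M 0 = x 0 + x 1 + x 2 + x 3 + x 4" if "0 < n"
    by (subst row[OF that, of "{1,2,3,4}"]) auto
  have r1: "M 1 = x 0 + x 1 + x 2 + x 3 + x 5" if "1 < n"
    by (subst row[OF that, of "{0,2,3,5}"]) auto
  have r2: "M 2 = x 0 + x 1 + x 2 + x 4 + x 6" if "2 < n"
    by (subst row[OF that, of "{0,1,4,6}"]) auto
  have r3: "M 3 = x 0 + x 1 + x 3 + x 5 + x 7" if "3 < n"
    by (subst row[OF that, of "{0,1,5,7}"]) auto
  have r4: "M (k + 4) = x k + x (k + 2) + x (k + 4) + x (k + 6) + x (k + 8)" if "k + 4 < n" for k
    by (subst row[OF that, of "{k, k + 2, k + 6, k + 8}"]) auto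
  consider "i = 0" | "i = 1" | "i = 2" | "i = 3" | k where "i = k + 4"
    by (cases "i < 4") (fastforce, metis add.commute le_Suc_ex not_less)
  then show ?thesis
  proof cases
    case 1 then show ?thesis using r0 r1 i le[of 4 5] by simp
  next
    case 2 then show ?thesis using r1 r2 i le[of 3 4] le[of 5 6] by (simp add: numeral_2_eq_2)
  next
    case 3 then show ?thesis using r2 r3 i le[of 2 3] le[of 4 5] le[of 6 7] by simp
  next
    case 4 then show ?thesis
      using r3 r4[of 0] i le[of 1 2] le[of 3 4] le[of 5 6] le[of 7 8] by (simp add: numeral_2_eq_2)
  next
    case 5 then show ?thesis
      using r4[of k] r4[of "Suc k"] i le[of k "Suc k"] le[of "k+2" "Suc k+2"] le[of "k+4" "Suc k+4"]
        le[of "k+6" "Suc k+6"] le[of "k+8" "Suc k+8"] by simp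
  qed
qed

lemma path_square_perron_vector:
  assumes n: "0 < n"
  obtains y and r :: real where "antimono y" "\<And>i. i < n \<Longrightarrow> 0 < y i"
    "\<And>i. i < n \<Longrightarrow> (\<Sum>j<n. if parent_sq path_parent n i j then y j else 0) = r * y i"
proof -
  let ?R = "parent_sq path_parent n"
  let ?K0 = "{x :: nat \<Rightarrow> real. (\<forall>i. 0 \<le> x i) \<and> (\<forall>i\<ge>n. x i = 0)}"
  define K where "K = ?K0 \<inter> {x. \<forall>i. x (Suc i) \<le> x i}"
  define a where "a i j = of_bool (?R i j) + (if i = j then 1 else 0 :: real)" for i j
  have M: "(\<Sum>j<n. a i j * x j) = (\<Sum>j<n. if ?R i j then x j else 0) + x i" if "i < n" for i x
  proof -
    have "(\<Sum>j<n. a i j * x j) = (\<Sum>j<n. (if ?R i j then x j else 0) + (if i = j then x j else 0))"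
      by (intro sum.cong) (auto simp: a_def)
    then show ?thesis using that by (simp add: sum.distrib)
  qed
  define e where "e i = (if i < n then 1 else 0 :: real)" for i
  have "e \<noteq> (\<lambda>_. 0)" using n by (auto simp: e_def fun_eq_iff)
  obtain y m where y: "y \<in> K" "(\<Sum>i<n. (y i)\<^sup>2) = 1"
    and ev: "\<And>i. i < n \<Longrightarrow> (\<Sum>j<n. a i j * y j) = m * y i"
  proof (rule cone_rayleigh_eigenvector[of a K n e])
    show "closed K" unfolding K_def
      by (intro closed_Int closed_nonneg_supported closed_Collect_all closed_Collect_le
          continuous_on_product_coordinates)
    show "(\<lambda>i. x i + t * y i) \<in> K" if "x \<in> K" "y \<in> K" "0 \<le> t" for x y t
    proof -
      have "x i + t * y i = 0" if "\<not> i < n" for i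
        using that \<open>x \<in> K\<close> \<open>y \<in> K\<close> by (auto simp: K_def)
      moreover have "x (Suc i) + t * y (Suc i) \<le> x i + t * y i" for i
        using that by (auto simp: K_def intro!: add_mono mult_left_mono)
      ultimately show ?thesis using that by (auto simp: K_def)
    qed
    show "(\<lambda>i. if i < n then \<Sum>j<n. a i j * x j else 0) \<in> K" if x: "x \<in> K" for x
    proof -
      have "antimono x" using x by (intro decseq_SucI) (auto simp: K_def)
      moreover have "x i = 0" if "n \<le> i" for i using x that by (auto simp: K_def)
      ultimately have "(\<Sum>j<n. a (Suc i) j * x j) \<le> (\<Sum>j<n. a i j * x j)" if "Suc i < n" for i
        using path_row_antimono[of n x i] that by (simp add: M)
      moreover have "0 \<le> (\<Sum>j<n. a i j * x j)" for i
        using x by (intro sum_nonneg) (auto simp: K_def a_def)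
      ultimately show ?thesis by (auto simp: K_def)
    qed
    show "a i j = a j i" for i j by (auto simp: a_def parent_sq_commute[of _ _ i])
    show "x i = 0" if "x \<in> K" "n \<le> i" for x i using that by (auto simp: K_def)
  qed (use \<open>e \<noteq> (\<lambda>_. 0)\<close> in \<open>auto simp: K_def e_def\<close>)
  have anti: "antimono y" using y by (intro decseq_SucI) (auto simp: K_def)
  have nonneg: "0 \<le> y i" for i using y by (auto simp: K_def)
  \<comment> \<open>Removing the identity from \<open>a\<close> lowers the eigenvalue by 1.\<close>
  have ev': "(\<Sum>j<n. if ?R i j then y j else 0) = (m - 1) * y i" if "i < n" for i
    using ev[OF that] M[OF that, of y] by (simp add: algebra_simps)
  have pos: "0 < y i" if "i < n" for i
    using that
  proof (induction i rule: less_induct)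
    case (less i)
    show ?case
    proof (cases "i = 0")
      case True
      \<comment> \<open>The first entry is the largest, so if it were 0 then \<open>y\<close> would
        vanish, against its norm 1.\<close>
      have "y j = 0" if "y 0 = 0" for j
        using nonneg[of j] antimonoD[OF anti, of 0 j] that by simp
      then show ?thesis using y(2) nonneg[of 0] True by force
    next
      case False
      define k where "k = path_parent i"
      have k: "k < i" "k < n" "?R i k"
        using False less.prems by (auto simp: k_def path_parent_def parent_sq_def parent_adj_def)
      \<comment> \<open>Otherwise the nonnegative terms of row \<open>i\<close> sum to 0, which
        forces \<open>y k = 0\<close> at the earlier neighbour \<open>k\<close>.\<close>
      have "y i \<noteq> 0"
      proof
        assume "y i = 0"
        then have "(\<Sum>j<n. if ?R i j then y j else 0) = 0" using ev'[OF less.prems] by simp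
        then have "\<forall>j\<in>{..<n}. (if ?R i j then y j else 0) = 0"
          by (subst (asm) sum_nonneg_eq_0_iff) (auto simp: nonneg)
        then have "y k = 0" using k by (auto dest!: bspec[of _ _ k])
        then show False using k less.IH[of k] by simp
      qed
      then show ?thesis using nonneg[of i] by simp
    qed
  qed
  show thesis using that[OF anti pos ev'] .
qed

section \<open>Rank-by-rank comparison of a tree with the path\<close>

lemma sum_earlier_ge:
  fixes y :: "nat \<Rightarrow> real"
  assumes "S \<subseteq> {i. i < j \<and> R i j}" "\<And>i. i < j \<Longrightarrow> 0 \<le> y i"
  shows "sum y S \<le> (\<Sum>i<j. if R i j then y i else 0)"
proof -
  have "sum y S \<le> sum y {i. i < j \<and> R i j}"
    using assms by (intro sum_mono2) auto
  also have "\<dots> = (\<Sum>i<j. if R i j then y i else 0)"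
    by (subst sum.inter_filter[symmetric]) (auto intro!: sum.cong)
  finally show ?thesis .
qed

text \<open>At \<open>j = 3\<close> the truncated \<open>j - 4\<close> is 0, matching the pair 0-3
  across the middle. The formula starts at 3 because the earlier neighbours of rank 2 are 0 and
  1.\<close>

lemma path_earlier_sum:
  fixes y :: "nat \<Rightarrow> real"
  assumes "3 \<le> j" "j < n"
  shows "(\<Sum>i<j. if parent_sq path_parent n i j then y i else 0) = y (j - 2) + y (j - 4)"
proof -
  have "(\<Sum>i<j. if parent_sq path_parent n i j then y i else 0)
      = (\<Sum>i<j. if i \<in> {j - 2, j - 4} then y i else 0)"
    using assms by (intro sum.cong refl if_cong) (auto simp: parent_sq_path_parent_iff)
  also have "\<dots> = sum y ({..<j} \<inter> {j - 2, j - 4})"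
    by (rule sum.inter_restrict[symmetric]) simp
  also have "{..<j} \<inter> {j - 2, j - 4} = {j - 2, j - 4}" using assms by auto
  finally show ?thesis using assms by simp
qed

lemma path_earlier_sum_le:
  fixes y :: "nat \<Rightarrow> real" and p :: "nat \<Rightarrow> nat"
  assumes p: "\<And>j. j < n \<Longrightarrow> p j \<le> j - 2" and j: "j < n"
    and anti: "antimono y" and pos: "\<And>i. i < n \<Longrightarrow> 0 < y i"
  shows "(\<Sum>i<j. if parent_sq path_parent n i j then y i else 0)
      \<le> (\<Sum>i<j. if parent_sq p n i j then y i else 0)"
    and "p j \<noteq> path_parent j \<Longrightarrow> (\<And>i. i < j \<Longrightarrow> p i = path_parent i) \<Longrightarrow>
      (\<Sum>i<j. if parent_sq path_parent n i j then y i else 0)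
      < (\<Sum>i<j. if parent_sq p n i j then y i else 0)"
proof -
  have nonneg: "0 \<le> y i" if "i < j" for i using pos[of i] that j by simp
  have le: "y b \<le> y a" if "a \<le> b" for a b using anti that by (rule antimonoD)
  \<comment> \<open>The second earlier neighbour: the grandparent or, if the parent is the root,
    rank 1, which is a child of the root since \<open>p 1 <= 1 - 2 = 0\<close>.\<close>
  define s where "s = (if p j = 0 then 1 else p (p j))"
  have pj: "p j \<le> j - 2" using p j by simp
  have adj: "parent_adj p (p i) i" if "0 < i" "i < n" for i
    using p[OF that(2)] that by (auto simp: parent_adj_def)
  have s: "s < j" "s \<noteq> p j" "parent_sq p n s j" "y (j - 2) + y (j - 4) \<le> y (p j) + y s"
    if j3: "3 \<le> j"
  proof -
    have ppj: "p (p j) \<le> p j - 2" using p[of "p j"] pj j by linarith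
    show "s < j" using j3 pj ppj unfolding s_def by (cases "p j = 0") auto
    show ne: "s \<noteq> p j" using ppj unfolding s_def by (cases "p j = 0") auto
    have "parent_adj p s (p j)"
      using adj[of 1] adj[of "p j"] p[of 1] pj j3 j by (auto simp: s_def parent_adj_commute)
    then show "parent_sq p n s j"
      using adj[of j] j3 pj j \<open>s < j\<close> unfolding parent_sq_def by (metis less_imp_neq le_less_trans less_le_trans not_less diff_le_self zero_less_numeral)
    show "y (j - 2) + y (j - 4) \<le> y (p j) + y s"
    proof (cases "p j = 0")
      case True
      \<comment> \<open>Here the pairing is crossed: \<open>y s = y 1\<close> bounds
        \<open>y (j - 2)\<close>, while \<open>y (p j) = y 0\<close> bounds
        \<open>y (j - 4)\<close>.\<close>
      have "y (j - 2) \<le> y 1" using j3 by (intro le) linarith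
      then show ?thesis using True le[of 0 "j - 4"] by (simp add: s_def)
    next
      case False
      then have "p (p j) \<le> j - 4" using p[of "p j"] pj j j3 by linarith
      then show ?thesis using False le[OF pj] le[of "p (p j)" "j - 4"] by (simp add: s_def)
    qed
  qed
  have sq: "parent_sq p n (p j) j" "p j < j" if "0 < j"
    using adj[OF that j] p[OF j] that by (auto simp: parent_sq_def)
  show "(\<Sum>i<j. if parent_sq path_parent n i j then y i else 0)
      \<le> (\<Sum>i<j. if parent_sq p n i j then y i else 0)"
  proof (cases "3 \<le> j")
    case True
    have "sum y {p j, s} \<le> (\<Sum>i<j. if parent_sq p n i j then y i else 0)"
      using s[OF True] sq True nonneg by (intro sum_earlier_ge) auto
    then show ?thesis using s[OF True] by (simp add: path_earlier_sum[OF True j])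
  next
    case False
    \<comment> \<open>The bound on \<open>p\<close> forces ranks 1 and 2 to be children of 0, so
      ranks 0, 1, 2 are pairwise adjacent in both squares.\<close>
    have "parent_sq path_parent n i j \<longleftrightarrow> parent_sq p n i j" if ij: "i < j" for i
    proof -
      consider "i = 0" "j = 1" | "i = 0" "j = 2" | "i = 1" "j = 2" using ij False by linarith
      then have "parent_sq p n i j"
      proof cases
        case 3
        then show ?thesis using adj[of 1] adj[of 2] p[of 1] p[of 2] j
          unfolding parent_sq_def by (auto simp: parent_adj_commute intro!: exI[of _ 0])
      qed (use sq p[OF j] in auto)
      moreover have "parent_sq path_parent n i j"
        using ij j False by (subst parent_sq_path_parent_iff) auto
      ultimately show ?thesis by simp
    qed
    then show ?thesis by (intro eq_refl sum.cong) auto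
  qed
  assume ne: "p j \<noteq> path_parent j" and eq: "\<And>i. i < j \<Longrightarrow> p i = path_parent i"
  have j3: "3 \<le> j" using ne pj by (auto simp: path_parent_def)
  \<comment> \<open>The path gives \<open>t\<close> the parent \<open>p j\<close>. Since
    \<open>p j < j - 2\<close>, \<open>t\<close> comes before \<open>j\<close>, where
    \<open>p\<close> agrees with the path, so \<open>t\<close> is a sibling of
    \<open>j\<close>.\<close>
  define t where "t = p j + 2"
  have t: "t < j" "p t = p j" using pj ne eq[of t] j3 by (auto simp: t_def path_parent_def)
  have "parent_sq p n t j"
    using adj[of t] adj[of j] t j sq j3 unfolding parent_sq_def
    by (auto simp: parent_adj_commute t_def intro!: exI[of _ "p j"])
  moreover have "p (p j) \<le> p j" using p[of "p j"] pj j by linarith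
  then have "t \<noteq> s" "t \<noteq> p j" by (auto simp: t_def s_def)
  ultimately have "sum y {p j, s, t} \<le> (\<Sum>i<j. if parent_sq p n i j then y i else 0)"
    using s[OF j3] sq j3 t nonneg by (intro sum_earlier_ge) auto
  then show "(\<Sum>i<j. if parent_sq path_parent n i j then y i else 0)
      < (\<Sum>i<j. if parent_sq p n i j then y i else 0)"
    using s[OF j3] pos[of t] t j \<open>t \<noteq> s\<close> \<open>t \<noteq> p j\<close> by (simp add: path_earlier_sum[OF j3 j])
qed

section \<open>Enumerating trees\<close>

text \<open>Trees grown one leaf at a time, each edge present in both orientations. This supplies
  the induction principle that connectedness and absence of cycles do not give directly.\<close>

inductive leaf_tree :: "'a set \<Rightarrow> 'a rel \<Rightarrow> bool" where
  single: "leaf_tree {v} {}"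
| attach: "leaf_tree V E \<Longrightarrow> u \<in> V \<Longrightarrow> v \<notin> V \<Longrightarrow>
    leaf_tree (insert v V) (insert (u, v) (insert (v, u) E))"

lemma leaf_tree_finite: "leaf_tree V E \<Longrightarrow> finite V"
  by (induction rule: leaf_tree.induct) auto

lemma leaf_tree_subset: "leaf_tree V E \<Longrightarrow> E \<subseteq> V \<times> V"
  by (induction rule: leaf_tree.induct) auto

lemma leaf_tree_irrefl: "leaf_tree V E \<Longrightarrow> (x, x) \<notin> E"
  by (induction rule: leaf_tree.induct) auto

lemma leaf_tree_sym: "leaf_tree V E \<Longrightarrow> (x, y) \<in> E \<Longrightarrow> (y, x) \<in> E"
  by (induction rule: leaf_tree.induct) auto

lemma leaf_tree_no_isolated:
  "leaf_tree V E \<Longrightarrow> x \<in> V \<Longrightarrow> V \<noteq> {x} \<Longrightarrow> \<exists>y. (x, y) \<in> E"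
  by (induction rule: leaf_tree.induct) auto

text \<open>The removed leaf need not be the one attached last. Its removal commutes with the last
  attachment, unless it is the new leaf itself or the vertex to which that leaf was
  attached.\<close>

lemma leaf_tree_remove_leaf:
  assumes "leaf_tree V E" "E `` {u} = {p}"
  shows "leaf_tree (V - {u}) (E - {(u, p), (p, u)})"
  using assms
proof (induction arbitrary: p rule: leaf_tree.induct)
  case (attach V E w v)
  let ?E = "insert (w, v) (insert (v, w) E)"
  have sub: "E \<subseteq> V \<times> V" by (rule leaf_tree_subset[OF attach.hyps(1)])
  have "w \<noteq> v" using attach.hyps by auto
  consider "u = v" | "u \<noteq> v" "u = w" | "u \<noteq> v" "u \<noteq> w" by blast
  then show ?case
  proof cases
    case 1
    have "p \<in> ?E `` {u}" using attach.prems by simp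
    then have "p = w" using 1 sub attach.hyps by auto
    moreover have "?E - {(v, w), (w, v)} = E" using sub attach.hyps by auto
    moreover have "insert v V - {v} = V" using attach.hyps by auto
    ultimately show ?thesis using 1 attach.hyps(1) by simp
  next
    case 2
    have "v \<in> ?E `` {u}" using 2 by auto
    then have p: "p = v" using attach.prems by simp
    \<comment> \<open>The only neighbour of \<open>u\<close> is the new leaf, so the tree before the
      attachment was the single vertex \<open>u\<close>.\<close>
    have iso: "(u, y) \<notin> E" for y
    proof
      assume "(u, y) \<in> E"
      then have "y \<in> ?E `` {u}" by auto
      then have "y = v" using attach.prems p by simp
      then show False using \<open>(u, y) \<in> E\<close> sub attach.hyps by auto
    qed
    then have V: "V = {u}" using leaf_tree_no_isolated[OF attach.hyps(1)] attach.hyps(2) 2 by blast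
    then have "E = {}" using sub iso by auto
    then show ?thesis using V p 2 leaf_tree.single[of v] by (simp add: insert_commute insert_Diff_if)
  next
    case 3
    then have "E `` {u} = {p}" using attach.prems by auto
    moreover from this have "p \<noteq> v" using sub attach.hyps by auto
    ultimately have "leaf_tree (insert v (V - {u})) (insert (w, v) (insert (v, w) (E - {(u, p), (p, u)})))"
      using attach 3 by (intro leaf_tree.attach) auto
    moreover have "insert v (V - {u}) = insert v V - {u}" using 3 by auto
    moreover have "insert (w, v) (insert (v, w) (E - {(u, p), (p, u)})) = ?E - {(u, p), (p, u)}"
      using 3 \<open>p \<noteq> v\<close> by auto
    ultimately show ?thesis by simp
  qed
qed auto

text \<open>The conditions \<open>p \<noteq> w\<close> and \<open>q \<noteq> u\<close> ensure that
  the neighbours survive when both leaves are removed.\<close>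

lemma leaf_tree_star_or_two_leaves:
  assumes "leaf_tree V E"
  shows "(\<exists>c\<in>V. E = {c} \<times> (V - {c}) \<union> (V - {c}) \<times> {c}) \<or>
    (\<exists>u p w q. u \<noteq> w \<and> E `` {u} = {p} \<and> E `` {w} = {q} \<and> p \<noteq> q \<and> p \<noteq> w \<and> q \<noteq> u)"
  using assms
proof (induction rule: leaf_tree.induct)
  case (attach V E x v)
  let ?E = "insert (x, v) (insert (v, x) E)"
  have sub: "E \<subseteq> V \<times> V" by (rule leaf_tree_subset[OF attach.hyps(1)])
  have v: "?E `` {v} = {x}" using sub attach.hyps by auto
  from attach.IH show ?case
  proof (elim disjE bexE exE conjE)
    fix c assume c: "c \<in> V" "E = {c} \<times> (V - {c}) \<union> (V - {c}) \<times> {c}"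
    \<comment> \<open>A new leaf at the centre keeps the star; at the other end of a single edge it
      makes that end the centre; at a ray with another ray \<open>l\<close> present, the new leaf
      and \<open>l\<close> have distinct neighbours.\<close>
    consider "x = c" | "x \<noteq> c" "V = {c, x}" | l where "x \<noteq> c" "l \<in> V" "l \<noteq> c" "l \<noteq> x"
      using attach.hyps(2) c(1) by blast
    then show ?thesis
    proof cases
      case 1
      then have "?E = {c} \<times> (insert v V - {c}) \<union> (insert v V - {c}) \<times> {c}"
        using c attach.hyps by auto
      then show ?thesis using c(1) by blast
    next
      case 2
      then have "?E = {x} \<times> (insert v V - {x}) \<union> (insert v V - {x}) \<times> {x}"
        using c attach.hyps by auto
      then show ?thesis using attach.hyps(2) by blast
    next
      case 3
      have l: "?E `` {l} = {c}" using 3 c attach.hyps by auto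
      have "v \<noteq> l" "x \<noteq> c" "x \<noteq> l" "c \<noteq> v" using 3 c(1) attach.hyps(3) by auto
      with v l show ?thesis by metis
    qed
  next
    fix u p w q
    assume uw: "u \<noteq> w" "E `` {u} = {p}" "E `` {w} = {q}" "p \<noteq> q" "p \<noteq> w" "q \<noteq> u"
    have mem: "u \<in> V" "p \<in> V" "w \<in> V" "q \<in> V" using uw sub by auto
    have old: "?E `` {z} = E `` {z}" if "z \<in> V" "z \<noteq> x" for z
      using that attach.hyps by auto
    \<comment> \<open>The attachment spoils at most one of the two leaves, and the new leaf takes
      its place.\<close>
    consider "x = u" | "x = w" | "x \<noteq> u" "x \<noteq> w" by blast
    then show ?thesis
    proof cases
      case 1
      have w: "?E `` {w} = {q}" using uw(1,3) old[of w] mem 1 by simp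
      have "v \<noteq> w" "x \<noteq> q" "x \<noteq> w" "q \<noteq> v" using uw mem 1 attach.hyps(3) by auto
      with v w show ?thesis by metis
    next
      case 2
      have u: "?E `` {u} = {p}" using uw(1,2) old[of u] mem 2 by simp
      have "v \<noteq> u" "x \<noteq> p" "x \<noteq> u" "p \<noteq> v" using uw mem 2 attach.hyps(3) by auto
      with v u show ?thesis by metis
    next
      case 3
      then have "?E `` {u} = {p}" "?E `` {w} = {q}" using uw(2,3) old mem by simp_all
      with uw(1,4-6) show ?thesis by metis
    qed
  qed
qed auto

section \<open>Listing a tree with parents at least two ranks back\<close>

definition parent_enum :: "'a rel \<Rightarrow> 'a list \<Rightarrow> (nat \<Rightarrow> nat) \<Rightarrow> bool" where
  "parent_enum E xs p \<longleftrightarrow> distinct xs \<and> E \<subseteq> set xs \<times> set xs \<and>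
     (\<forall>i<length xs. \<forall>j<length xs. (xs ! i, xs ! j) \<in> E \<longleftrightarrow> parent_adj p i j)"

lemma parent_enum_snoc:
  assumes "parent_enum E xs p" "a < length xs" "u \<notin> set xs"
  shows "parent_enum (E \<union> {(u, xs ! a), (xs ! a, u)}) (xs @ [u]) (p(length xs := a))"
proof -
  let ?n = "length xs" and ?E = "E \<union> {(u, xs ! a), (xs ! a, u)}"
    and ?p = "p(length xs := a)" and ?xs = "xs @ [u]"
  have sub: "E \<subseteq> set xs \<times> set xs" and dist: "distinct xs"
    and adj: "\<And>i j. i < ?n \<Longrightarrow> j < ?n \<Longrightarrow> (xs ! i, xs ! j) \<in> E \<longleftrightarrow> parent_adj p i j"
    using assms(1) by (auto simp: parent_enum_def)
  have ne: "xs ! i \<noteq> u" if "i < ?n" for i using that assms(3) by auto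
  have eq: "xs ! i = xs ! a \<longleftrightarrow> i = a" if "i < ?n" for i
    using that dist assms(2) by (simp add: nth_eq_iff_index_eq)
  have "(?xs ! i, ?xs ! j) \<in> ?E \<longleftrightarrow> parent_adj ?p i j" if ij: "i < Suc ?n" "j < Suc ?n" for i j
  proof -
    consider "i < ?n" "j < ?n" | "i = ?n" "j < ?n" | "i < ?n" "j = ?n" | "i = ?n" "j = ?n"
      using ij by linarith
    then show ?thesis
    proof cases
      case 1
      then show ?thesis using adj[of i j] ne by (auto simp: nth_append parent_adj_def)
    next
      case 2
      then show ?thesis using sub assms(3) ne eq[of j]
        by (auto simp: nth_append parent_adj_def)
    next
      case 3
      then show ?thesis using sub assms(3) ne eq[of i]
        by (auto simp: nth_append parent_adj_def)
    next
      case 4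
      then show ?thesis using sub assms(3) ne[OF assms(2)] by (auto simp: parent_adj_def)
    qed
  qed
  then show ?thesis using sub dist assms(2,3) by (auto simp: parent_enum_def)
qed

lemma leaf_tree_parent_enum:
  assumes "leaf_tree V E"
  shows "\<exists>xs p. parent_enum E xs p \<and> set xs = V \<and> (\<forall>j<length xs. p j \<le> j - 2)"
  using assms
proof (induction "card V" arbitrary: V E rule: less_induct)
  case less
  note fin = leaf_tree_finite[OF less.prems]
  note sub = leaf_tree_subset[OF less.prems]
  from leaf_tree_star_or_two_leaves[OF less.prems] show ?case
  proof (elim disjE bexE exE conjE)
    fix c assume c: "c \<in> V" "E = {c} \<times> (V - {c}) \<union> (V - {c}) \<times> {c}"
    obtain ys where ys: "set ys = V - {c}" "distinct ys"
      using finite_distinct_list[of "V - {c}"] fin by auto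
    have iff: "(c # ys) ! i = c \<longleftrightarrow> i = 0" "(c # ys) ! i \<in> V" if "i < length (c # ys)" for i
    proof -
      show "(c # ys) ! i = c \<longleftrightarrow> i = 0"
      proof (cases i)
        case (Suc k)
        then have "ys ! k \<in> V - {c}" using that ys(1) nth_mem[of k ys] by simp
        then show ?thesis using Suc by auto
      qed simp
      have "set (c # ys) = V" using ys(1) c(1) by auto
      then show "(c # ys) ! i \<in> V" using nth_mem[OF that] by blast
    qed
    have "parent_enum E (c # ys) (\<lambda>_. 0)"
      unfolding parent_enum_def
    proof (intro conjI allI impI)
      fix i j assume "i < length (c # ys)" "j < length (c # ys)"
      then show "((c # ys) ! i, (c # ys) ! j) \<in> E \<longleftrightarrow> parent_adj (\<lambda>_. 0) i j"
        using iff[of i] iff[of j] unfolding c(2) parent_adj_def by auto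
    qed (use ys c in auto)
    then show ?thesis using ys c(1) by (intro exI[of _ "c # ys"] exI[of _ "\<lambda>_. 0"]) auto
  next
    \<comment> \<open>The two leaves receive ranks \<open>length xs\<close> and
      \<open>length xs + 1\<close> with parents \<open>a < b < length xs\<close>. Hence
      \<open>a <= length xs - 2\<close> and \<open>b <= length xs - 1\<close>, exactly the required
      bounds. Stated for general names so that it serves both orders of the parents.\<close>
    have main: ?thesis
      if uw: "u \<noteq> w" "E `` {u} = {xs ! a}" "E `` {w} = {xs ! b}"
        and ab: "a < b" "b < length xs"
        and xs: "parent_enum (E - {(u, xs ! a), (xs ! a, u)} - {(w, xs ! b), (xs ! b, w)}) xs p"
        "set xs = V - {u, w}" "\<forall>j<length xs. p j \<le> j - 2" for u w xs a b p
    proof -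
      let ?n = "length xs"
      let ?F = "E - {(u, xs ! a), (xs ! a, u)} - {(w, xs ! b), (xs ! b, w)}"
      let ?q = "p(?n := a, Suc ?n := b)"
      have mem: "u \<in> V" "w \<in> V" "(u, xs ! a) \<in> E" "(w, xs ! b) \<in> E" using uw sub by auto
      have "parent_enum (?F \<union> {(u, xs ! a), (xs ! a, u)}) (xs @ [u]) (p(?n := a))"
        using ab xs by (intro parent_enum_snoc) auto
      from parent_enum_snoc[OF this, of b w]
      have "parent_enum (?F \<union> {(u, xs ! a), (xs ! a, u)} \<union> {(w, xs ! b), (xs ! b, w)})
          (xs @ [u, w]) ?q"
        using ab xs uw(1) by (simp add: nth_append)
      moreover have "?F \<union> {(u, xs ! a), (xs ! a, u)} \<union> {(w, xs ! b), (xs ! b, w)} = E"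
        using mem leaf_tree_sym[OF less.prems] by auto
      moreover have "?q j \<le> j - 2" if "j < length (xs @ [u, w])" for j
        using that ab xs(3) by (auto simp: less_Suc_eq)
      moreover have "set (xs @ [u, w]) = V" using xs(2) mem by auto
      ultimately show ?thesis by metis
    qed
    fix u p w q
    assume uw: "u \<noteq> w" "E `` {u} = {p}" "E `` {w} = {q}" "p \<noteq> q" "p \<noteq> w" "q \<noteq> u"
    let ?F = "E - {(u, p), (p, u)} - {(w, q), (q, w)}"
    have mem: "u \<in> V" "p \<in> V" "w \<in> V" "q \<in> V" "(u, p) \<in> E" "(w, q) \<in> E" using uw sub by auto
    then have "p \<noteq> u" "q \<noteq> w" using leaf_tree_irrefl[OF less.prems] by auto
    have "(E - {(u, p), (p, u)}) `` {w} = {q}" using uw by auto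
    then have "leaf_tree (V - {u} - {w}) ?F"
      using leaf_tree_remove_leaf[OF leaf_tree_remove_leaf[OF less.prems uw(2)]] by blast
    moreover have "V - {u} - {w} = V - {u, w}" by auto
    moreover have "card (V - {u, w}) < card V"
      using fin mem by (intro psubset_card_mono) auto
    ultimately obtain xs p' where xs: "parent_enum ?F xs p'" "set xs = V - {u, w}"
        "\<forall>j<length xs. p' j \<le> j - 2"
      using less.hyps[of "V - {u, w}" ?F] by auto
    have "p \<in> set xs" "q \<in> set xs" using xs(2) mem uw \<open>p \<noteq> u\<close> \<open>q \<noteq> w\<close> by auto
    then obtain a b where ab: "a < length xs" "xs ! a = p" "b < length xs" "xs ! b = q"
      by (auto simp: in_set_conv_nth)
    with uw(4) have "a < b \<or> b < a" by (metis linorder_neqE_nat)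
    then show ?thesis
    proof
      assume "a < b"
      then show ?thesis using main[of u w xs a b p'] uw xs ab by simp
    next
      assume "b < a"
      moreover have "?F = E - {(w, q), (q, w)} - {(u, p), (p, u)}" by auto
      moreover have "V - {u, w} = V - {w, u}" by auto
      ultimately show ?thesis using main[of w u xs b a p'] uw xs ab by simp
    qed
  qed
qed

section \<open>Undirected trees and graph squares\<close>

lemma pawalk_verts_snoc:
  "pcas a p u \<Longrightarrow> pawalk_verts a (p @ [(u, v)]) = pawalk_verts a p @ [v]"
  by (induction p arbitrary: a) auto

lemma pcas_snoc: "pcas a p u \<Longrightarrow> pcas a (p @ [(u, v)]) v"
  by (induction p arbitrary: a) auto

text \<open>Used to close a cycle: two arcs from an outside vertex into the tree, completed by such
  a path.\<close>

lemma leaf_tree_path: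
  assumes "leaf_tree V E" "a \<in> V" "b \<in> V"
  shows "\<exists>p. pcas a p b \<and> set p \<subseteq> E \<and> distinct (pawalk_verts a p) \<and> set (pawalk_verts a p) \<subseteq> V"
  using assms
proof (induction arbitrary: a b rule: leaf_tree.induct)
  case (single v)
  then show ?case by (intro exI[of _ "[]"]) auto
next
  case (attach V E u v)
  consider "a \<in> V" "b \<in> V" | "a = v" "b = v" | "a = v" "b \<in> V" | "a \<in> V" "b = v"
    using attach.prems by blast
  then show ?case
  proof cases
    case 1
    then show ?thesis using attach.IH[of a b] by (meson order_trans subset_insertI)
  next
    case 2
    then show ?thesis by (intro exI[of _ "[]"]) auto
  next
    case 3
    obtain p where "pcas u p b" "set p \<subseteq> E" "distinct (pawalk_verts u p)" "set (pawalk_verts u p) \<subseteq> V"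
      using attach.IH[of u b] attach.hyps 3 by auto
    then show ?thesis using attach.hyps 3 by (intro exI[of _ "(v, u) # p"]) auto
  next
    case 4
    obtain p where "pcas a p u" "set p \<subseteq> E" "distinct (pawalk_verts a p)" "set (pawalk_verts a p) \<subseteq> V"
      using attach.IH[of a u] attach.hyps 4 by auto
    then show ?thesis using attach.hyps 4
      by (intro exI[of _ "p @ [(u, v)]"]) (auto simp: pcas_snoc pawalk_verts_snoc)
  qed
qed

text \<open>Connectedness is defined through the symmetric closure, which adds no arcs here. A walk
  that leaves \<open>S\<close> must use a crossing arc.\<close>

lemma connected_crossing_arc:
  assumes G: "pair_graph G" and conn: "Digraph_Component.connected (with_proj G)"
    and S: "S \<noteq> {}" "S \<subset> pverts G"
  obtains a b where "a \<in> S" "b \<in> pverts G - S" "(a, b) \<in> parcs G"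
proof -
  interpret pair_graph G by (rule G)
  obtain s t where st: "s \<in> S" "t \<in> pverts G - S" using S by blast
  let ?H = "mk_symmetric (with_proj G)"
  have "s \<rightarrow>\<^sup>*\<^bsub>with_proj ?H\<^esub> t"
    using conn st S by (auto simp: Digraph_Component.connected_def strongly_connected_def mk_symmetric_def)
  then have "(s, t) \<in> (parcs ?H)\<^sup>*"
    using reachable_rtranclI[of "with_proj ?H" s t] by simp
  moreover have "parcs ?H \<subseteq> parcs G"
    using pair_sym_arcs by (auto simp: mk_symmetric_def symmetric_def dest: symD)
  ultimately have "(s, t) \<in> (parcs G)\<^sup>*" by (meson rtrancl_mono subsetD)
  then have "t \<in> S \<or> (\<exists>a b. a \<in> S \<and> b \<in> pverts G - S \<and> (a, b) \<in> parcs G)"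
  proof induction
    case (step y z)
    then show ?case using in_arcsD2 by blast
  qed (use st in auto)
  then show thesis using st that by blast
qed

text \<open>A largest vertex set inducing a leaf tree is everything: otherwise some arc leaves it,
  and by acyclicity the outer endpoint has only one neighbour inside, so it could be attached as a
  leaf.\<close>

lemma undirected_tree_leaf_tree:
  assumes "undirected_tree G"
  shows "leaf_tree (pverts G) (parcs G)"
proof -
  have G: "pair_graph G" and conn: "Digraph_Component.connected (with_proj G)"
    and acyc: "\<not> (\<exists>p. pre_digraph.cycle (with_proj G) p \<and> length p \<ge> 3)"
    using assms by (auto simp: undirected_tree_def)
  interpret pair_graph G by (rule G)
  define P where "P S \<longleftrightarrow> S \<subseteq> pverts G \<and> leaf_tree S (parcs G \<inter> S \<times> S)" for S
  have noloop: "(v, v) \<notin> parcs G" for v using no_loops'[of v v] by blast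
  have sym: "(v, u) \<in> parcs G" if "(u, v) \<in> parcs G" for u v
    using pair_sym_arcs that by (auto simp: symmetric_def dest: symD)
  obtain v where "v \<in> pverts G"
    using conn by (auto simp: Digraph_Component.connected_def strongly_connected_def mk_symmetric_def)
  moreover have "parcs G \<inter> {v} \<times> {v} = {}" using noloop by auto
  ultimately have "P {v}" using leaf_tree.single[of v] by (simp add: P_def)
  moreover have "\<forall>S. P S \<longrightarrow> card S < Suc (card (pverts G))"
    using card_mono[OF pair_finite_verts] by (simp add: P_def less_Suc_eq_le)
  ultimately have "\<exists>S. P S \<and> (\<forall>S'. P S' \<longrightarrow> card S' \<le> card S)"
    by (rule ex_has_greatest_nat)
  then obtain S where "P S" and max: "\<And>S'. P S' \<Longrightarrow> card S' \<le> card S" by blast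
  then have S: "S \<subseteq> pverts G" "leaf_tree S (parcs G \<inter> S \<times> S)" by (auto simp: P_def)
  have "S = pverts G"
  proof (rule ccontr)
    assume "S \<noteq> pverts G"
    moreover have "S \<noteq> {}" using S(2) by (auto elim: leaf_tree.cases)
    ultimately obtain a b where ab: "a \<in> S" "b \<in> pverts G - S" "(a, b) \<in> parcs G"
      using connected_crossing_arc[OF G conn, of S] S(1) by blast
    have unique: "a' = a" if a': "a' \<in> S" "(a', b) \<in> parcs G" for a'
    proof (rule ccontr)
      assume "a' \<noteq> a"
      obtain p where p: "pcas a' p a" "set p \<subseteq> parcs G" "distinct (pawalk_verts a' p)"
          "set (pawalk_verts a' p) \<subseteq> S"
        using leaf_tree_path[OF S(2) a'(1) ab(1)] by blast
      \<comment> \<open>Since \<open>a' \<noteq> a\<close>, the path \<open>p\<close> is nonempty,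
        so the closed walk has length at least 3. Its inner vertices are distinct and lie in
        \<open>S\<close>, which \<open>b\<close> does not.\<close>
      let ?c = "(b, a') # p @ [(a, b)]"
      have "p \<noteq> []" using p(1) \<open>a' \<noteq> a\<close> by auto
      then have "length ?c \<ge> 3" by (cases p) auto
      moreover have "pcas b ?c b"
        by (simp only: pcas.simps fst_conv snd_conv simp_thms pcas_snoc[OF p(1)])
      then have "awalk b ?c b"
        unfolding awalk_def using p(2) ab a' sym by auto
      moreover have "distinct (tl (pawalk_verts b ?c))"
        using p ab by (auto simp: pawalk_verts_snoc)
      ultimately show False using acyc unfolding cycle_def by blast
    qed
    have "parcs G \<inter> insert b S \<times> insert b S = insert (a, b) (insert (b, a) (parcs G \<inter> S \<times> S))"
    proof (rule subset_antisym; rule subrelI)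
      fix x y assume xy: "(x, y) \<in> parcs G \<inter> insert b S \<times> insert b S"
      then have "x = b \<Longrightarrow> y = a" "y = b \<Longrightarrow> x = a"
        using unique[of x] unique[of y] sym[of x y] noloop[of b] by auto
      then show "(x, y) \<in> insert (a, b) (insert (b, a) (parcs G \<inter> S \<times> S))" using xy by blast
    next
      fix x y assume "(x, y) \<in> insert (a, b) (insert (b, a) (parcs G \<inter> S \<times> S))"
      then show "(x, y) \<in> parcs G \<inter> insert b S \<times> insert b S" using ab(1,3) sym[OF ab(3)] by blast
    qed
    then have "P (insert b S)"
      using leaf_tree.attach[OF S(2), of a b] S(1) ab by (simp add: P_def)
    moreover have "finite S" using S(1) pair_finite_verts finite_subset by blast
    ultimately show False using max[of "insert b S"] ab by simp
  qed
  moreover have "parcs G \<inter> pverts G \<times> pverts G = parcs G"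
    using wellformed' by auto
  ultimately show ?thesis using S(2) by simp
qed

section \<open>Squares described by common neighbours\<close>

lemma graph_dist_eq_2_iff:
  assumes G: "pair_graph G"
  shows "graph_dist G u v = 2 \<longleftrightarrow>
    u \<noteq> v \<and> (u, v) \<notin> parcs G \<and> (\<exists>w. (u, w) \<in> parcs G \<and> (w, v) \<in> parcs G)"
    (is "_ \<longleftrightarrow> ?R")
proof -
  interpret pair_graph G by (rule G)
  have dist: "graph_dist G u v = (INF p\<in>{p. awalk u p v}. ereal (real (length p)))"
    unfolding graph_dist_def \<mu>_def by (simp add: awalk_cost_def sum_list_triv)
  show ?thesis
  proof
    assume d: "graph_dist G u v = 2"
    \<comment> \<open>An infimum below 3 yields a walk of length less than 3, and every walk has
      length at least 2; so a walk of length exactly 2 exists.\<close>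
    then have "graph_dist G u v < ereal 3" by simp
    then obtain p where p: "awalk u p v" "length p < 3"
      unfolding dist by (auto simp: INF_less_iff)
    have lower: "2 \<le> length q" if "awalk u q v" for q
    proof -
      have "ereal 2 \<le> ereal (real (length q))"
        using d that unfolding dist by (metis INF_lower mem_Collect_eq numeral_eq_ereal)
      then show ?thesis by simp
    qed
    from lower[OF p(1)] p(2) have "length p = 2" by simp
    then obtain e f where "p = [e, f]" by (auto simp: numeral_2_eq_2 length_Suc_conv)
    then have "\<exists>w. (u, w) \<in> parcs G \<and> (w, v) \<in> parcs G" and "u \<in> pverts G"
      using p(1) by (cases e; cases f; auto simp: awalk_def)+
    moreover have "u \<noteq> v"
      using lower[of "[]"] \<open>u \<in> pverts G\<close> by (auto simp: awalk_def)
    moreover have "(u, v) \<notin> parcs G"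
      using lower[of "[(u, v)]"] \<open>u \<in> pverts G\<close> by (auto simp: awalk_def)
    ultimately show ?R by blast
  next
    assume ?R
    then obtain w where w: "u \<noteq> v" "(u, v) \<notin> parcs G" "(u, w) \<in> parcs G" "(w, v) \<in> parcs G" by blast
    have "awalk u [(u, w), (w, v)] v" using w in_arcsD1 by (auto simp: awalk_def)
    then have "graph_dist G u v \<le> ereal (real (length [(u, w), (w, v)]))"
      unfolding dist by (intro INF_lower) simp
    moreover have "ereal 2 \<le> graph_dist G u v"
      unfolding dist
    proof (rule INF_greatest)
      fix p assume "p \<in> {p. awalk u p v}"
      then have p: "awalk u p v" by simp
      have "p \<noteq> []" using p w by (auto simp: awalk_def)
      moreover have "length p \<noteq> 1" using p w by (auto simp: awalk_def length_Suc_conv)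
      ultimately have "2 \<le> length p" by (cases p) (auto simp: Suc_le_eq)
      then show "ereal 2 \<le> ereal (real (length p))" by simp
    qed
    ultimately show "graph_dist G u v = 2" by (intro antisym) simp_all
  qed
qed

lemma parcs_graph_square_iff:
  assumes G: "pair_graph G"
  shows "(u, v) \<in> parcs (graph_square G) \<longleftrightarrow>
    u \<noteq> v \<and> ((u, v) \<in> parcs G \<or> (\<exists>w. (u, w) \<in> parcs G \<and> (w, v) \<in> parcs G))"
proof -
  interpret pair_graph G by (rule G)
  have "(u, v) \<in> parcs (graph_square G) \<longleftrightarrow>
      (u, v) \<in> parcs G \<or> u \<in> pverts G \<and> v \<in> pverts G \<and> graph_dist G u v = 2"
    unfolding graph_square_def by simp
  then show ?thesis
    unfolding graph_dist_eq_2_iff[OF G] using no_loops'[of u v] wellformed' by blast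
qed

lemma parcs_graph_square_enum:
  assumes G: "pair_graph G" and E: "parent_enum (parcs G) xs p"
    and ij: "i < length xs" "j < length xs"
  shows "(xs ! i, xs ! j) \<in> parcs (graph_square G) \<longleftrightarrow> parent_sq p (length xs) i j"
proof -
  have sub: "parcs G \<subseteq> set xs \<times> set xs" and dist: "distinct xs"
    and adj: "\<And>i j. i < length xs \<Longrightarrow> j < length xs \<Longrightarrow>
      (xs ! i, xs ! j) \<in> parcs G \<longleftrightarrow> parent_adj p i j"
    using E by (auto simp: parent_enum_def)
  have "(\<exists>w. (xs ! i, w) \<in> parcs G \<and> (w, xs ! j) \<in> parcs G) \<longleftrightarrow>
      (\<exists>k<length xs. (xs ! i, xs ! k) \<in> parcs G \<and> (xs ! k, xs ! j) \<in> parcs G)"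
    (is "?L \<longleftrightarrow> ?R")
  proof
    assume ?L
    then obtain w where w: "(xs ! i, w) \<in> parcs G" "(w, xs ! j) \<in> parcs G" by blast
    then have "w \<in> set xs" using sub by blast
    then obtain k where "k < length xs" "w = xs ! k" unfolding in_set_conv_nth by blast
    with w show ?R by blast
  qed blast
  then show ?thesis
    using ij dist adj by (auto simp: parcs_graph_square_iff[OF G] parent_sq_def nth_eq_iff_index_eq)
qed

section \<open>The middle-outwards listing of the path\<close>

lemma path_graph_pair_graph: "pair_graph (path_graph n)"
proof unfold_locales
  show "finite (parcs (path_graph n))"
    by (rule finite_subset[of _ "{..<n} \<times> {..<n}"]) (auto simp: path_graph_def)
qed (auto simp: path_graph_def symmetric_def intro!: symI)

text \<open>With \<open>c = (n - 1) div 2\<close> and \<open>n > 0\<close>, the even ranks below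
  \<open>n\<close> are as many as the vertices \<open>0..c\<close>, so both sides are exhausted
  exactly.\<close>

definition zigzag :: "nat \<Rightarrow> nat \<Rightarrow> nat" where
  "zigzag n j = (if even j then (n - 1) div 2 - j div 2 else (n - 1) div 2 + (j + 1) div 2)"

lemma path_graph_parent_enum:
  "parent_enum (parcs (path_graph n)) (map (zigzag n) [0..<n]) path_parent"
  "set (map (zigzag n) [0..<n]) = {..<n}"
proof -
  define c where "c = (n - 1) div 2"
  have even: "zigzag n (2 * a) = c - a" and odd: "zigzag n (2 * a + 1) = c + a + 1" for a
    by (simp_all add: zigzag_def c_def)
  have even_le: "a \<le> c" if "2 * a < n" for a using that unfolding c_def by linarith
  have odd_less: "c + a + 1 < n" if "2 * a + 1 < n" for a using that unfolding c_def by linarith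
  have parity: "(\<exists>a. j = 2 * a) \<or> (\<exists>a. j = 2 * a + 1)" for j :: nat
    by (meson evenE oddE)
  have lt: "zigzag n j < n" if "j < n" for j
    using parity[of j] that even_le odd_less by (auto simp: even odd[simplified] c_def)
  have inj: "inj_on (zigzag n) {..<n}"
  proof (rule inj_onI)
    fix i j assume ij: "i \<in> {..<n}" "j \<in> {..<n}" "zigzag n i = zigzag n j"
    then show "i = j"
      using parity[of i] parity[of j] even_le[of "i div 2"] even_le[of "j div 2"]
      by (elim disjE exE; simp add: even odd[simplified]; arith)
  qed
  have set: "zigzag n ` {..<n} = {..<n}"
    using endo_inj_surj[OF _ _ inj] lt by auto
  then show *: "set (map (zigzag n) [0..<n]) = {..<n}" by (simp add: lessThan_atLeast0)
  have "(zigzag n i, zigzag n j) \<in> parcs (path_graph n) \<longleftrightarrow> parent_adj path_parent i j"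
    if "i < n" "j < n" for i j
  proof -
    have "zigzag n j = Suc (zigzag n i) \<or> zigzag n i = Suc (zigzag n j) \<longleftrightarrow> parent_adj path_parent i j"
      using parity[of i] parity[of j]
    proof (elim disjE exE)
      fix a b assume ij: "i = 2 * a" "j = 2 * b"
      have "a \<le> c" "b \<le> c" using ij that even_le by auto
      then show ?thesis unfolding ij even parent_adj_path_parent_iff by linarith
    next
      fix a b assume ij: "i = 2 * a" "j = 2 * b + 1"
      have "a \<le> c" using ij that even_le by auto
      \<comment> \<open>Vertices on opposite sides are adjacent only along the middle edge, between
        ranks 0 and 1.\<close>
      then have "c + b + 1 = Suc (c - a) \<or> c - a = Suc (c + b + 1) \<longleftrightarrow> a = 0 \<and> b = 0" by auto
      moreover have "parent_adj path_parent (2 * a) (2 * b + 1) \<longleftrightarrow> a = 0 \<and> b = 0"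
        unfolding parent_adj_path_parent_iff by presburger
      ultimately show ?thesis unfolding ij even odd by simp
    next
      fix a b assume ij: "i = 2 * a + 1" "j = 2 * b"
      have "b \<le> c" using ij that even_le by auto
      then have "c - b = Suc (c + a + 1) \<or> c + a + 1 = Suc (c - b) \<longleftrightarrow> a = 0 \<and> b = 0" by auto
      moreover have "parent_adj path_parent (2 * a + 1) (2 * b) \<longleftrightarrow> a = 0 \<and> b = 0"
        unfolding parent_adj_path_parent_iff by presburger
      ultimately show ?thesis unfolding ij even odd by simp
    next
      fix a b assume ij: "i = 2 * a + 1" "j = 2 * b + 1"
      then show ?thesis unfolding ij odd parent_adj_path_parent_iff by auto
    qed
    then show ?thesis using lt that by (simp add: path_graph_def)
  qed
  moreover have "parcs (path_graph n) \<subseteq> {..<n} \<times> {..<n}" by (auto simp: path_graph_def)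
  ultimately show "parent_enum (parcs (path_graph n)) (map (zigzag n) [0..<n]) path_parent"
    unfolding parent_enum_def * using inj by (simp add: distinct_map lessThan_atLeast0)
qed

section \<open>Enumerations and isomorphism\<close>

lemma graph_spectral_radius_square_cong:
  assumes "pair_graph G" "parent_enum (parcs G) xs p" "set xs = pverts G"
    and "pair_graph H" "parent_enum (parcs H) ys p" "set ys = pverts H"
    and "length xs = length ys"
  shows "graph_spectral_radius (graph_square G) = graph_spectral_radius (graph_square H)"
proof -
  have dist: "distinct xs" "distinct ys" using assms by (auto simp: parent_enum_def)
  have "adjacency_mat (graph_square G) xs = adjacency_mat (graph_square H) ys"
    using assms(7) parcs_graph_square_enum[OF assms(1,2)] parcs_graph_square_enum[OF assms(4,5)]
    by (auto simp: adjacency_mat_def)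
  then show ?thesis
    using graph_spectral_radius_eq[OF dist(1), of "graph_square G"]
      graph_spectral_radius_eq[OF dist(2), of "graph_square H"] assms(3,6)
    by (simp add: graph_square_def)
qed

lemma digraph_iso_parent_enum:
  assumes iso: "digraph_iso (with_proj G) (with_proj H)"
    and E: "parent_enum (parcs G) xs p" "set xs = pverts G"
  obtains ys where "parent_enum (parcs H) ys p" "set ys = pverts H" "length ys = length xs"
proof -
  obtain f where f: "pre_digraph.digraph_isomorphism (with_proj G) f"
    and H: "with_proj H = app_iso f (with_proj G)"
    using iso by (auto simp: digraph_iso_def)
  let ?g = "iso_verts f"
  have V: "pverts H = ?g ` pverts G" and A: "parcs H = iso_arcs f ` parcs G"
    and ht: "iso_head f = snd" "iso_tail f = fst"
    using H by (auto simp: with_proj_def app_iso_def)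
  have inj: "inj_on ?g (pverts G)"
    using f by (simp add: pre_digraph.digraph_isomorphism_def)
  \<comment> \<open>An isomorphism maps arcs by a separate function, but as heads and tails in
    \<open>H\<close> are the components of pairs, that function is determined by the vertex
    map.\<close>
  have "iso_arcs f a = (?g (fst a), ?g (snd a))" if "a \<in> parcs G" for a
    using f that ht by (simp add: pre_digraph.digraph_isomorphism_def prod_eq_iff)
  then have A: "parcs H = (\<lambda>a. (?g (fst a), ?g (snd a))) ` parcs G"
    unfolding A by (rule image_cong[OF refl])
  have sub: "parcs G \<subseteq> pverts G \<times> pverts G" and dist: "distinct xs"
    using E by (auto simp: parent_enum_def)
  have arc: "(?g u, ?g v) \<in> parcs H \<longleftrightarrow> (u, v) \<in> parcs G" if "u \<in> pverts G" "v \<in> pverts G" for u v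
  proof
    assume "(?g u, ?g v) \<in> parcs H"
    then obtain u' v' where "(u', v') \<in> parcs G" "?g u = ?g u'" "?g v = ?g v'"
      unfolding A by auto
    moreover from this have "u = u'" "v = v'" using sub inj that by (auto dest: inj_onD)
    ultimately show "(u, v) \<in> parcs G" by simp
  next
    assume "(u, v) \<in> parcs G"
    then show "(?g u, ?g v) \<in> parcs H" unfolding A by (rule rev_image_eqI) simp
  qed
  have mem: "xs ! i \<in> pverts G" if "i < length xs" for i using nth_mem[OF that] E(2) by simp
  have "parent_enum (parcs H) (map ?g xs) p"
    unfolding parent_enum_def
  proof (intro conjI allI impI)
    show "distinct (map ?g xs)" using dist inj E(2) by (simp add: distinct_map)
    show "parcs H \<subseteq> set (map ?g xs) \<times> set (map ?g xs)"
      using sub E(2) unfolding A by auto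
    show "(map ?g xs ! i, map ?g xs ! j) \<in> parcs H \<longleftrightarrow> parent_adj p i j"
      if "i < length (map ?g xs)" "j < length (map ?g xs)" for i j
      using that E(1) arc[OF mem mem, of i j] by (simp add: parent_enum_def)
  qed
  then show thesis using E(2) V by (intro that[of "map ?g xs"]) auto
qed

lemma parent_enum_digraph_iso:
  fixes G :: "'a pair_pre_digraph" and H :: "'b pair_pre_digraph"
  assumes G: "pair_graph G" and xs: "parent_enum (parcs G) xs p" "set xs = pverts G"
    and ys: "parent_enum (parcs H) ys p" "set ys = pverts H"
    and len: "length xs = length ys"
  shows "digraph_iso (with_proj G) (with_proj H)"
proof -
  interpret pair_graph G by (rule G)
  let ?n = "length xs"
  have dist: "distinct xs" "distinct ys"
    and subG: "parcs G \<subseteq> set xs \<times> set xs" and subH: "parcs H \<subseteq> set ys \<times> set ys"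
    using xs(1) ys(1) by (auto simp: parent_enum_def)
  have adj: "(xs ! i, xs ! j) \<in> parcs G \<longleftrightarrow> (ys ! i, ys ! j) \<in> parcs H" if "i < ?n" "j < ?n" for i j
    using xs(1) ys(1) len that by (simp add: parent_enum_def)
  define g where "g u = ys ! (the_inv_into {..<?n} ((!) xs) u)" for u
  have g: "g (xs ! i) = ys ! i" if "i < ?n" for i
    using the_inv_into_f_f[of "(!) xs" "{..<?n}" i] that dist(1) by (simp add: g_def inj_on_nth)
  have inj: "inj_on g (pverts G)"
  proof (rule inj_onI)
    fix u v assume "u \<in> pverts G" "v \<in> pverts G" and eq: "g u = g v"
    then obtain i j where ij: "i < ?n" "u = xs ! i" "j < ?n" "v = xs ! j"
      unfolding xs(2)[symmetric] in_set_conv_nth by blast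
    then show "u = v" using eq g dist(2) len by (simp add: nth_eq_iff_index_eq)
  qed
  have verts: "g ` pverts G = pverts H"
  proof -
    have "map g xs = ys" using g len by (intro nth_equalityI) auto
    then have "g ` set xs = set ys" by (metis set_map)
    then show ?thesis by (simp add: xs ys)
  qed
  have arcs: "(\<lambda>(u, v). (g u, g v)) ` parcs G = parcs H"
  proof (rule subset_antisym; rule subsetI)
    fix a assume "a \<in> (\<lambda>(u, v). (g u, g v)) ` parcs G"
    then obtain u v where uv: "(u, v) \<in> parcs G" "a = (g u, g v)" by auto
    then obtain i j where "i < ?n" "u = xs ! i" "j < ?n" "v = xs ! j"
      using subG by (metis in_set_conv_nth mem_Sigma_iff subsetD)
    then show "a \<in> parcs H" using uv g adj by simp
  next
    fix a assume a: "a \<in> parcs H"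
    then obtain i j where ij: "i < ?n" "j < ?n" "a = (ys ! i, ys ! j)"
      using subH len by (metis in_set_conv_nth mem_Sigma_iff subsetD surj_pair)
    then have "(xs ! i, xs ! j) \<in> parcs G" using adj a by simp
    then show "a \<in> (\<lambda>(u, v). (g u, g v)) ` parcs G"
      by (rule rev_image_eqI) (simp add: ij g)
  qed
  define f :: "('a, 'a \<times> 'a, 'b, 'b \<times> 'b) digraph_isomorphism" where
    "f = \<lparr>iso_verts = g, iso_arcs = \<lambda>(u, v). (g u, g v), iso_head = snd, iso_tail = fst\<rparr>"
  have "inj_on (\<lambda>(u, v). (g u, g v)) (parcs G)"
    using inj subG xs(2) by (auto intro!: inj_onI dest: inj_onD)
  then have "pre_digraph.digraph_isomorphism (with_proj G) f"
    using inj wf_digraph_axioms by (auto simp: pre_digraph.digraph_isomorphism_def f_def)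
  moreover have "with_proj H = app_iso f (with_proj G)"
    using verts arcs by (simp add: app_iso_def f_def with_proj_def)
  ultimately show ?thesis unfolding digraph_iso_def by blast
qed

theorem theorem3p4:
  fixes T :: "'a pair_pre_digraph" and n :: nat
  assumes "undirected_tree T" and "card (pverts T) = n" and "n \<ge> 4"
  shows "graph_spectral_radius (graph_square T) \<ge> graph_spectral_radius (graph_square (path_graph n))
    \<and> (graph_spectral_radius (graph_square T) = graph_spectral_radius (graph_square (path_graph n))
         \<longleftrightarrow> digraph_iso (with_proj T) (with_proj (path_graph n)))"
proof -
  let ?P = "path_graph n"
  let ?rT = "graph_spectral_radius (graph_square T)" and ?rP = "graph_spectral_radius (graph_square ?P)"
  have T: "pair_graph T" using assms(1) by (simp add: undirected_tree_def)
  obtain xs p where xs: "parent_enum (parcs T) xs p" "set xs = pverts T"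
      and p': "\<forall>j<length xs. p j \<le> j - 2"
    using leaf_tree_parent_enum[OF undirected_tree_leaf_tree[OF assms(1)]] by blast
  have dist: "distinct xs" using xs(1) by (simp add: parent_enum_def)
  have len: "length xs = n" using distinct_card[OF dist] xs(2) assms(2) by simp
  have p: "p j \<le> j - 2" if "j < n" for j using p' that len by simp
  let ?ys = "map (zigzag n) [0..<n]"
  note ys = path_graph_parent_enum(1)[of n]
  have ys_set: "set ?ys = pverts ?P" using path_graph_parent_enum(2)[of n] by (simp add: path_graph_def)
  have n: "0 < n" using assms(3) by simp
  obtain y and r :: real where anti: "antimono y" and pos: "\<And>i. i < n \<Longrightarrow> 0 < y i"
    and ev: "\<And>i. i < n \<Longrightarrow> (\<Sum>j<n. if parent_sq path_parent n i j then y j else 0) = r * y i"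
    by (rule path_square_perron_vector[OF n]) (rule that)
  \<comment> \<open>The spectral radii are separated by \<open>?rP <= r\<close> and
    \<open>m <= ?rT\<close>; testing the form of the tree square at \<open>y\<close> then gives
    \<open>r <= m\<close>.\<close>
  have rP: "?rP \<le> r"
  proof (rule graph_spectral_radius_le_of_positive_eigenvector[of ?ys])
    show "distinct ?ys" using ys by (simp add: parent_enum_def)
    show "set ?ys = pverts (graph_square ?P)" using ys_set by (simp add: graph_square_def)
    show "(v, u) \<in> parcs (graph_square ?P)" if "(u, v) \<in> parcs (graph_square ?P)" for u v
      using that unfolding parcs_graph_square_iff[OF path_graph_pair_graph] by (auto simp: path_graph_def)
    show "(\<Sum>j<length ?ys. if (?ys ! i, ?ys ! j) \<in> parcs (graph_square ?P) then y j else 0) = r * y i"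
      if "i < length ?ys" for i
    proof -
      have "(\<Sum>j<length ?ys. if (?ys ! i, ?ys ! j) \<in> parcs (graph_square ?P) then y j else 0)
          = (\<Sum>j<length ?ys. if parent_sq path_parent (length ?ys) i j then y j else 0)"
        using that by (intro sum.cong if_cong refl parcs_graph_square_enum[OF path_graph_pair_graph ys]) auto
      then show ?thesis using ev[of i] that by simp
    qed
  qed (use pos n in auto)
  obtain x and m :: real where x: "\<exists>i<n. x i \<noteq> 0"
    and xev: "\<And>i. i < n \<Longrightarrow> (\<Sum>j<n. if parent_sq p n i j then x j else 0) = m * x i"
    and bound: "\<And>y. \<forall>i<n. 0 \<le> y i \<Longrightarrow>
      (\<Sum>i<n. \<Sum>j<n. if parent_sq p n i j then y i * y j else 0) \<le> m * (\<Sum>i<n. (y i)\<^sup>2)"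
    by (rule nonneg_rayleigh_maximum[OF parent_sq_commute n]) (rule that)
  have rT: "m \<le> ?rT"
  proof -
    obtain i where i: "i < n" "x i \<noteq> 0" using x by blast
    show ?thesis
    proof (rule eigenvalue_le_graph_spectral_radius[of xs _ i x])
      show "(\<Sum>j<length xs. if (xs ! i, xs ! j) \<in> parcs (graph_square T) then x j else 0) = m * x i"
        if "i < length xs" for i
      proof -
        have "(\<Sum>j<length xs. if (xs ! i, xs ! j) \<in> parcs (graph_square T) then x j else 0)
            = (\<Sum>j<length xs. if parent_sq p (length xs) i j then x j else 0)"
          using that by (intro sum.cong if_cong refl parcs_graph_square_enum[OF T xs(1)]) auto
        then show ?thesis using xev[of i] that len by simp
      qed
    qed (use dist xs len i in \<open>auto simp: graph_square_def\<close>)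
  qed
  let ?e = "\<lambda>q j. \<Sum>i<j. if parent_sq q n i j then y i else 0"
  have norm: "0 < (\<Sum>i<n. (y i)\<^sup>2)" using pos n by (intro sum_pos zero_less_power) auto
  have form: "(\<Sum>i<n. \<Sum>j<n. if parent_sq q n i j then y i * y j else 0) = 2 * (\<Sum>j<n. y j * ?e q j)" for q
    by (rule quadratic_form_eq_sum_earlier[OF parent_sq_commute parent_sq_irrefl])
  have "r * (\<Sum>i<n. (y i)\<^sup>2) = (\<Sum>i<n. y i * (\<Sum>j<n. if parent_sq path_parent n i j then y j else 0))"
    by (simp add: ev sum_distrib_left power2_eq_square mult_ac)
  also have "\<dots> = (\<Sum>i<n. \<Sum>j<n. if parent_sq path_parent n i j then y i * y j else 0)"
    by (simp add: sum_distrib_left if_distrib cong: if_cong)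
  finally have r: "r * (\<Sum>i<n. (y i)\<^sup>2) = 2 * (\<Sum>j<n. y j * ?e path_parent j)" by (simp add: form)
  have m: "2 * (\<Sum>j<n. y j * ?e p j) \<le> m * (\<Sum>i<n. (y i)\<^sup>2)"
    using bound[of y] pos unfolding form by (simp add: less_imp_le)
  have le: "y j * ?e path_parent j \<le> y j * ?e p j" if "j < n" for j
    using path_earlier_sum_le(1)[OF p that anti pos] pos[OF that] by (intro mult_left_mono) auto
  then have "(\<Sum>j<n. y j * ?e path_parent j) \<le> (\<Sum>j<n. y j * ?e p j)" by (intro sum_mono) auto
  with r m have "r * (\<Sum>i<n. (y i)\<^sup>2) \<le> m * (\<Sum>i<n. (y i)\<^sup>2)" by linarith
  with norm have "r \<le> m" by simp
  with rP rT have ge: "?rP \<le> ?rT" by linarith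
  have iso: "digraph_iso (with_proj T) (with_proj ?P)" if eq: "?rT = ?rP"
  proof -
    have "p j = path_parent j" if "j < n" for j
    proof (rule ccontr)
      assume "p j \<noteq> path_parent j"
      with that have "\<exists>j. j < n \<and> p j \<noteq> path_parent j" by blast
      then obtain k where k: "k < n" "p k \<noteq> path_parent k"
          and least: "\<forall>i<k. \<not> (i < n \<and> p i \<noteq> path_parent i)"
        \<comment> \<open>Minimality of \<open>k\<close> gives agreement with the path before
          \<open>k\<close>, which the strict comparison at \<open>k\<close> requires.\<close>
        unfolding exists_least_iff[of "\<lambda>j. j < n \<and> p j \<noteq> path_parent j"] by blast
      have "p i = path_parent i" if "i < k" for i
        using least that k(1) by simp
      then have "y k * ?e path_parent k < y k * ?e p k"
        using path_earlier_sum_le(2)[OF p k(1) anti pos k(2)] pos[OF k(1)] by (intro mult_strict_left_mono) auto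
      then have "(\<Sum>j<n. y j * ?e path_parent j) < (\<Sum>j<n. y j * ?e p j)"
        using k(1) le by (intro sum_strict_mono_ex1) auto
      with r m have "r * (\<Sum>i<n. (y i)\<^sup>2) < m * (\<Sum>i<n. (y i)\<^sup>2)" by linarith
      with norm have "r < m" by simp
      with rP rT eq show False by linarith
    qed
    \<comment> \<open>Agreement below \<open>n\<close> suffices, because only parents of listed
      ranks are consulted.\<close>
    then have "parent_enum (parcs T) xs path_parent"
      using xs(1) len by (auto simp: parent_enum_def parent_adj_def)
    then show ?thesis
      using parent_enum_digraph_iso[OF T _ xs(2) ys ys_set] len by simp
  qed
  have "?rT = ?rP" if iso': "digraph_iso (with_proj T) (with_proj ?P)"
  proof -
    \<comment> \<open>The isomorphism carries the listing of \<open>T\<close> to one of the path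
      with the same parent function, so the squares have equal adjacency matrices.\<close>
    obtain zs where zs: "parent_enum (parcs ?P) zs p" "set zs = pverts ?P" "length zs = length xs"
      by (rule digraph_iso_parent_enum[OF iso' xs])
    show ?thesis
      by (rule graph_spectral_radius_square_cong[OF T xs path_graph_pair_graph zs(1,2) zs(3)[symmetric]])
  qed
  with ge iso show ?thesis by blast
qed

end
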